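(* The directed power graph can be reconstructed from any power graph. That is, there is a procedure (algorithm) whose only input is a graph $\Gamma=(V,E)$ that is a power graph, which uses only arithmetical or graph-theoretical information about $\Gamma$ (and no information about any group $G$ with $\Gamma=\mathcal{P}(G)$), and which, for every power graph $\Gamma$, terminates and does one of the following: (1) it establishes that there is, up to isomorphism, a unique group $G$ such that $\Gamma=\mathcal{P}(G)$, and outputs such a $G$; (2) it outputs a digraph $\vec{\Gamma}$ such that $\vec{\Gamma}$ is isomorphic, as a digraph, to $\vec{\mathcal{P}}(G)$ for every group $G$ such that $\Gamma=\mathcal{P}(G)$.
   Context: All groups are finite. For a group $G$, the power graph $\mathcal{P}(G)$ is the simple undirected graph with vertex set $G$ in which distinct $x,y$ are adjacent iff there is a positive integer $m$ with $x=y^m$ or $y=x^m$. The directed power graph $\vec{\mathcal{P}}(G)$ is the digraph with vertex set $G$ and arc set $\{(x,y)\in G^2: x\neq y,\ y=x^m \text{ for some positive integer } m\}$. A graph $\Gamma$ is called a power graph if there exists a (finite) group $G$ with $\Gamma=\mathcal{P}(G)$ (so the vertex set of $\Gamma$ is the underlying set of $G$). *)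

theory Defs
  imports
    "HOL-Algebra.Group"
    "HOL-Library.Nat_Bijection"
    "Graph_Theory.Pair_Digraph"
    "Graph_Theory.Digraph_Isomorphism"
begin

section \<open>Power graphs\<close>

text \<open>
  As usual in Graph_Theory, an undirected graph is a symmetric digraph: each edge is
  represented by its two orientations.
\<close>

definition power_graph :: "('a, 'b) monoid_scheme \<Rightarrow> 'a pair_pre_digraph" where
  "power_graph G = \<lparr> pverts = carrier G,
     parcs = {(x, y). x \<in> carrier G \<and> y \<in> carrier G \<and> x \<noteq> y \<and>
       (\<exists>m::nat. m > 0 \<and> (x = y [^]\<^bsub>G\<^esub> m \<or> y = x [^]\<^bsub>G\<^esub> m))} \<rparr>"

definition directed_power_graph :: "('a, 'b) monoid_scheme \<Rightarrow> 'a pair_pre_digraph" where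
  "directed_power_graph G = \<lparr> pverts = carrier G,
     parcs = {(x, y). x \<in> carrier G \<and> y \<in> carrier G \<and> x \<noteq> y \<and>
       (\<exists>m::nat. m > 0 \<and> y = x [^]\<^bsub>G\<^esub> m)} \<rparr>"

definition finite_group :: "('a, 'b) monoid_scheme \<Rightarrow> bool" where
  "finite_group G \<longleftrightarrow> group G \<and> finite (carrier G)"

definition is_power_graph :: "'a pair_pre_digraph \<Rightarrow> bool" where
  "is_power_graph \<Gamma> \<longleftrightarrow> (\<exists>G :: 'a monoid. finite_group G \<and> \<Gamma> = power_graph G)"

lemma pair_graph_power_graph:
  assumes "finite_group G"
  shows "pair_graph (power_graph G)"
proof -
  have "finite (parcs (power_graph G))"
    by (rule finite_subset[of _ "carrier G \<times> carrier G"])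
       (use assms in \<open>auto simp: power_graph_def finite_group_def\<close>)
  then show ?thesis
    using assms
    by unfold_locales
      (auto simp: power_graph_def finite_group_def symmetric_def sym_def)
qed

lemma pair_digraph_directed_power_graph:
  assumes "finite_group G"
  shows "pair_digraph (directed_power_graph G)"
proof -
  have "finite (parcs (directed_power_graph G))"
    by (rule finite_subset[of _ "carrier G \<times> carrier G"])
       (use assms in \<open>auto simp: directed_power_graph_def finite_group_def\<close>)
  then show ?thesis
    using assms
    by unfold_locales (auto simp: directed_power_graph_def finite_group_def)
qed


section \<open>Algorithms: partial recursive functions\<close>

text \<open>
  Programs are not annotated with arities; a program applied to an argument list on which no
  rule below applies just has no value.
\<close>

datatype recf =
    Zero
  | Succ
  | Proj nat
  | Comp recf "recf list"
  | PrimRec recf recf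
  | Mu recf

inductive recf_eval :: "recf \<Rightarrow> nat list \<Rightarrow> nat \<Rightarrow> bool" where
  eval_Zero: "recf_eval Zero xs 0"
| eval_Succ: "recf_eval Succ (x # xs) (Suc x)"
| eval_Proj: "i < length xs \<Longrightarrow> recf_eval (Proj i) xs (xs ! i)"
| eval_Comp: "list_all2 (\<lambda>g y. recf_eval g xs y) gs ys \<Longrightarrow> recf_eval f ys z
    \<Longrightarrow> recf_eval (Comp f gs) xs z"
| eval_PrimRec_0: "recf_eval f xs y \<Longrightarrow> recf_eval (PrimRec f g) (0 # xs) y"
| eval_PrimRec_Suc: "recf_eval (PrimRec f g) (n # xs) y \<Longrightarrow> recf_eval g (n # y # xs) z
    \<Longrightarrow> recf_eval (PrimRec f g) (Suc n # xs) z"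
| eval_Mu: "recf_eval f (n # xs) 0 \<Longrightarrow> (\<And>m. m < n \<Longrightarrow> \<exists>y. y > 0 \<and> recf_eval f (m # xs) y)
    \<Longrightarrow> recf_eval (Mu f) xs n"

inductive_cases eval_ZeroE: "recf_eval Zero xs z"
inductive_cases eval_SuccE: "recf_eval Succ xs z"
inductive_cases eval_ProjE: "recf_eval (Proj i) xs z"
inductive_cases eval_CompE: "recf_eval (Comp f gs) xs z"
inductive_cases eval_PrimRec_0E: "recf_eval (PrimRec f g) (0 # xs) z"
inductive_cases eval_PrimRec_SucE: "recf_eval (PrimRec f g) (Suc n # xs) z"
inductive_cases eval_MuE: "recf_eval (Mu f) xs z"

lemma recf_eval_deterministic:
  assumes "recf_eval r xs y" and "recf_eval r xs z"
  shows "y = z"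
  using assms
proof (induction arbitrary: z rule: recf_eval.induct)
  case (eval_Comp xs gs ys f y)
  from eval_Comp.prems obtain ys' where
    ys': "list_all2 (\<lambda>g. recf_eval g xs) gs ys'" "recf_eval f ys' z"
    by (rule eval_CompE)
  have "ys = ys'"
    using eval_Comp.IH(1) ys'(1) by (auto simp: list_all2_conv_all_nth intro!: nth_equalityI)
  then show ?case using eval_Comp.IH(2) ys'(2) by blast
next
  case (eval_PrimRec_Suc f g n xs y z')
  from eval_PrimRec_Suc.prems obtain y' where
    "recf_eval (PrimRec f g) (n # xs) y'" "recf_eval g (n # y' # xs) z"
    by (rule eval_PrimRec_SucE)
  then show ?case using eval_PrimRec_Suc.IH by metis
next
  case (eval_Mu f n xs)
  from eval_Mu.prems have z: "recf_eval f (z # xs) 0"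
    "\<And>m. m < z \<Longrightarrow> \<exists>y. y > 0 \<and> recf_eval f (m # xs) y"
    by (auto elim: eval_MuE)
  show ?case
  proof (rule linorder_cases[of n z])
    assume "n < z"
    then show ?thesis using z(2) eval_Mu.IH(1) by fastforce
  next
    assume "z < n"
    then show ?thesis using z(1) eval_Mu.IH(2) by fastforce
  qed
next
  case (eval_PrimRec_0 f xs y g)
  from eval_PrimRec_0.prems have "recf_eval f xs z" by (rule eval_PrimRec_0E)
  then show ?case by (rule eval_PrimRec_0.IH)
next
  case (eval_Zero xs)
  then show ?case by (rule eval_ZeroE) simp
next
  case (eval_Succ x xs)
  then show ?case by (rule eval_SuccE) simp
next
  case (eval_Proj i xs)
  from eval_Proj.prems show ?case by (rule eval_ProjE) simp
qed


section \<open>Finite graphs and groups as inputs and outputs\<close>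

text \<open>
  Vertices and group elements are natural numbers, but the vertex set may be any finite set of
  them. The codes below are faithful on finite objects only, because \<^const>\<open>set_encode\<close> is
  injective on finite sets only.
\<close>

definition digraph_code :: "nat pair_pre_digraph \<Rightarrow> nat" where
  "digraph_code D = prod_encode (set_encode (pverts D), set_encode (prod_encode ` parcs D))"

definition group_code :: "nat monoid \<Rightarrow> nat" where
  "group_code G = prod_encode (set_encode (carrier G),
     set_encode ((\<lambda>(x, y). prod_encode (x, prod_encode (y, x \<otimes>\<^bsub>G\<^esub> y))) ` (carrier G \<times> carrier G)))"

datatype proc_output = Unique_Group "nat monoid" | Digraph "nat pair_pre_digraph"

fun output_code :: "proc_output \<Rightarrow> nat" where
  "output_code (Unique_Group G) = sum_encode (Inl (group_code G))"
| "output_code (Digraph D) = sum_encode (Inr (digraph_code D))"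

lemma digraph_code_inject:
  assumes "pair_fin_digraph D" "pair_fin_digraph D'" "digraph_code D = digraph_code D'"
  shows "D = D'"
proof -
  have fin: "finite (pverts D)" "finite (parcs D)" "finite (pverts D')" "finite (parcs D')"
    using assms(1,2) by (auto simp: pair_fin_digraph_def pair_fin_digraph_axioms_def)
  have "pverts D = pverts D'" "prod_encode ` parcs D = prod_encode ` parcs D'"
    using assms(3) fin by (auto simp: digraph_code_def set_encode_eq)
  moreover from this(2) have "parcs D = parcs D'"
    by (simp add: inj_image_eq_iff inj_prod_encode)
  ultimately show ?thesis by simp
qed

lemma group_code_inject:
  assumes "finite_group G" "finite_group H" "group_code G = group_code H"
  shows "carrier G = carrier H"
    and "\<And>x y. x \<in> carrier G \<Longrightarrow> y \<in> carrier G \<Longrightarrow> x \<otimes>\<^bsub>G\<^esub> y = x \<otimes>\<^bsub>H\<^esub> y"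
proof -
  let ?T = "\<lambda>K::nat monoid. (\<lambda>(x, y). prod_encode (x, prod_encode (y, x \<otimes>\<^bsub>K\<^esub> y))) ` (carrier K \<times> carrier K)"
  have fin: "finite (carrier G)" "finite (carrier H)"
    using assms(1,2) by (simp_all add: finite_group_def)
  have finT: "finite (?T G)" "finite (?T H)"
    by (rule finite_imageI[OF finite_cartesian_product[OF fin(1) fin(1)]],
        rule finite_imageI[OF finite_cartesian_product[OF fin(2) fin(2)]])
  have codes: "set_encode (carrier G) = set_encode (carrier H) \<and>
      set_encode (?T G) = set_encode (?T H)"
    using assms(3) unfolding group_code_def prod_encode_eq prod.inject .
  have eq: "carrier G = carrier H" "?T G = ?T H"
    by (rule set_encode_eq[OF fin, THEN iffD1, OF conjunct1[OF codes]],
        rule set_encode_eq[OF finT, THEN iffD1, OF conjunct2[OF codes]])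
  show "carrier G = carrier H" by (rule eq)
  fix x y assume "x \<in> carrier G" "y \<in> carrier G"
  then have "prod_encode (x, prod_encode (y, x \<otimes>\<^bsub>G\<^esub> y)) \<in> ?T G"
    by (intro rev_image_eqI[of "(x, y)"]) auto
  then have "prod_encode (x, prod_encode (y, x \<otimes>\<^bsub>G\<^esub> y)) \<in> ?T H"
    by (simp only: eq(2))
  then show "x \<otimes>\<^bsub>G\<^esub> y = x \<otimes>\<^bsub>H\<^esub> y" by auto
qed


section \<open>Reconstruction procedures\<close>

fun correct_output :: "nat pair_pre_digraph \<Rightarrow> proc_output \<Rightarrow> bool" where
  "correct_output \<Gamma> (Unique_Group G) \<longleftrightarrow>
     finite_group G \<and> \<Gamma> = power_graph G \<and>
     (\<forall>H :: nat monoid. finite_group H \<and> \<Gamma> = power_graph H \<longrightarrow> G \<cong> H)"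
| "correct_output \<Gamma> (Digraph D) \<longleftrightarrow>
     pair_digraph D \<and>
     (\<forall>G :: nat monoid. finite_group G \<and> \<Gamma> = power_graph G \<longrightarrow>
        digraph_iso (with_proj D) (with_proj (directed_power_graph G)))"

text \<open>
  Outputs agreeing up to isomorphism. A procedure that uses only graph-theoretical information
  must give such outputs on isomorphic graphs: the names of the vertices do not matter.
\<close>

fun output_iso :: "proc_output \<Rightarrow> proc_output \<Rightarrow> bool" where
  "output_iso (Unique_Group G) (Unique_Group H) \<longleftrightarrow> G \<cong> H"
| "output_iso (Digraph D) (Digraph D') \<longleftrightarrow> digraph_iso (with_proj D) (with_proj D')"
| "output_iso _ _ \<longleftrightarrow> False"

end

theory Submission
  imports
    Defs
    "HOL-Algebra.Multiplicative_Group"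
    "HOL-Algebra.Sylow"
    "HOL-Number_Theory.Totient"
begin

text \<open>
  The procedure always answers with a digraph. It searches, in a fixed order, for the
  multiplication table of some group G on the vertex set of \<Gamma> with \<Gamma> = P(G), and returns the
  directed power graph of G. Deciding whether a number codes such a table needs only quantifiers
  bounded by the numbers at hand, so the search is an unbounded minimisation over a decidable relation
  (reconstruction_program). That the answer does not depend on which G the search finds, nor on
  the names of the vertices, is the mathematical content: groups with isomorphic power graphs have
  isomorphic directed power graphs (directed_power_graph_determined). The rest of this
  introduction explains why this holds.

  Let G and H be finite groups with the same underlying set and the same power graph, so with the
  same closed neighbourhoods. Call x and y twins if their closed neighbourhoods coincide, and call
  x a star if it is adjacent to everything else.

  Inside one twin class almost nothing can happen. If x is a twin of a power y \<noteq> 1 of smaller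
  order, then every divisor of the order of x is comparable, under divisibility, with the order of
  y, which forces the order of x to be a prime power (twin_prime_power). So apart
  from the class of the stars in some cyclic groups, each twin class is the upper part, of all elements of order at least some m, of a cyclic group generated by a member
  w of maximal order (twins_upward_closed).

  Between two different twin classes that contain no stars the direction of the arcs can be read
  off the graph. If y is a power of x, then the class of y is smaller than the class of x, except
  when the order of x is twice the odd order of y (card_twins_below). If G and H disagreed about
  the direction, both would be in the exceptional case, and the involution of G below x leads to a
  contradiction (directions_not_opposite).

  The stars themselves leave two possibilities (stars_dichotomy). Either the group is cyclic of an
  order that is not a prime power, or the stars form a cyclic subgroup of prime power order. By
  Cauchy's theorem one power graph cannot show both (cyclic_not_stars_low). In the first case, G
  and H are cyclic of equal order and matched by an order-preserving bijection. In the second, all arcs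
  between twin classes have the same direction in G and H. So a maximal cyclic group of a class,
  being the class together with everything strictly below it, is the same set for G and H. The
  size of this set and the size of the class determine how many elements of each order the class
  has (orders_in_class_agree). A bijection that preserves the twin class and carries orders in G
  to orders in H is then an isomorphism of the directed power graphs.
\<close>

section \<open>Divisors and the totient function\<close>

definition prime_power_or_1 :: "nat \<Rightarrow> bool" where
  "prime_power_or_1 n \<longleftrightarrow> (\<exists>p k. prime p \<and> n = p ^ k)"

lemma prime_power_or_1_dvd:
  assumes "prime_power_or_1 n" "m dvd n"
  shows "prime_power_or_1 m"
  using assms unfolding prime_power_or_1_def by (metis divides_primepow_nat)

lemma prime_power_divisors_comparable:
  assumes "prime_power_or_1 n" "a dvd n" "b dvd n"
  shows "a dvd b \<or> b dvd a"
proof -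
  obtain p k where p: "prime p" "n = p ^ k" using assms(1) unfolding prime_power_or_1_def by blast
  obtain i where "a = p ^ i" using divides_primepow_nat[OF p(1)] assms(2) p(2) by auto
  moreover obtain j where "b = p ^ j" using divides_primepow_nat[OF p(1)] assms(3) p(2) by auto
  ultimately show ?thesis by (metis le_imp_power_dvd linear)
qed

lemma other_prime_divisor:
  fixes n p :: nat
  assumes "prime p" "n > 0" "\<not> prime_power_or_1 n"
  shows "\<exists>q. prime q \<and> q dvd n \<and> q \<noteq> p"
proof -
  obtain r where r: "n = p ^ multiplicity p n * r" "\<not> p dvd r"
    using multiplicity_decompose'[of n p] assms by (metis gr_implies_not0 not_prime_unit)
  have "r \<noteq> 1" using r(1) assms unfolding prime_power_or_1_def by (metis mult.right_neutral)
  then obtain q where "prime q" "q dvd r" using prime_factor_nat by blast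
  then show ?thesis using r by (metis dvd_mult)
qed

text \<open>
  The arithmetic behind every argument that an order must be a prime power. If m is not a prime
  power, the full power in n of a prime at which m and n differ works. If m is a prime power and n
  is not, another prime divisor of n works.
\<close>

lemma incomparable_divisor:
  assumes "n > 0" "m dvd n" "m \<noteq> n"
    and "\<not> prime_power_or_1 m \<or> (\<not> prime_power_or_1 n \<and> m \<noteq> 1)"
  shows "\<exists>d. d dvd n \<and> \<not> d dvd m \<and> \<not> m dvd d"
proof (cases "prime_power_or_1 m")
  case False
  have m0: "m > 0" using assms(1,2) by (auto intro: gr0I)
  have "\<not> n dvd m" using assms(2,3) by (metis dvd_antisym)
  then obtain p where p: "prime p" "\<not> multiplicity p n \<le> multiplicity p m"
    using m0 assms(1) by (metis multiplicity_le_imp_dvd neq0_conv)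
  let ?d = "p ^ multiplicity p n"
  have "?d dvd n" by (rule multiplicity_dvd)
  moreover have "\<not> ?d dvd m"
    using p m0 by (metis multiplicity_geI not_prime_unit neq0_conv)
  moreover have "\<not> m dvd ?d"
    using False prime_power_or_1_dvd p(1) prime_power_or_1_def by blast
  ultimately show ?thesis by blast
next
  case True
  then obtain p k where p: "prime p" "m = p ^ k" unfolding prime_power_or_1_def by blast
  have k: "k > 0" using True assms(4) p(2) by (auto intro: gr0I)
  obtain q where q: "prime q" "q dvd n" "q \<noteq> p"
    using other_prime_divisor[OF p(1) assms(1)] True assms(4) by blast
  have "\<not> q dvd m" using p q by (metis prime_dvd_power primes_dvd_imp_eq)
  moreover have "\<not> m dvd q"
    using p q k by (metis dvd_power dvd_trans primes_dvd_imp_eq)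
  ultimately show ?thesis using q(2) by blast
qed

text \<open>
  The exceptional case a = 2 * b is what prevents the sizes of twin classes from determining all
  directions.
\<close>

lemma totient_dvd_eqD:
  fixes a b :: nat
  assumes "a > 0" "b dvd a" and eq: "totient b = totient a"
  shows "a = b \<or> a = 2 * b \<and> odd b"
proof -
  obtain k where k: "a = b * k" using assms(2) by blast
  have pos: "b > 0" "k > 0" using assms(1) k by auto
  have g: "totient a * totient (gcd b k) = totient b * totient k * gcd b k"
    using totient_gcd[of b k] k by simp
  have "totient b * totient k * totient (gcd b k) \<le> totient a * totient (gcd b k)"
    unfolding g by (simp add: totient_le)
  then have le: "totient b * totient k \<le> totient a"
    using pos by simp
  have "\<not> k > 2"
  proof
    assume "k > 2"
    then have "totient k > 1" by (rule totient_gt_1)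
    then have "totient b * totient k > totient b" using pos by simp
    then show False using le eq by simp
  qed
  then have "k = 1 \<or> k = 2" using pos by linarith
  then show "a = b \<or> a = 2 * b \<and> odd b"
  proof
    assume "k = 2"
    then show ?thesis using eq totient_double[of b] k pos by (auto simp: mult.commute split: if_splits)
  qed (use k in simp)
qed

lemma totient_prime_power_ge:
  assumes "prime_power_or_1 n" "m dvd n" "m \<noteq> n"
  shows "m \<le> totient n"
proof -
  obtain p k where p: "prime p" "n = p ^ k" using assms(1) unfolding prime_power_or_1_def by blast
  obtain j where j: "m = p ^ j" "j \<le> k" using divides_primepow_nat[OF p(1)] assms(2) p(2) by auto
  then have jk: "j < k" using assms(3) p(2) by (cases "j = k") auto
  have p2: "p \<ge> 2" using p(1) by (rule prime_ge_2_nat)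
  have "p ^ j * 1 \<le> p ^ (k - 1) * (p - 1)"
    using jk p2 by (intro mult_le_mono power_increasing) auto
  then show ?thesis using totient_prime_power[OF p(1)] p(2) j(1) jk by simp
qed

section \<open>Cyclic subgroups and closed neighbourhoods\<close>

text \<open>
  In a finite group this is the subgroup generated by x, described by natural exponents as in the
  definition of the power graphs.
\<close>

definition cyc :: "('a, 'b) monoid_scheme \<Rightarrow> 'a \<Rightarrow> 'a set" where
  "cyc G x = range (\<lambda>k::nat. x [^]\<^bsub>G\<^esub> k)"

text \<open>
  The closed neighbourhood of x in the power graph.
\<close>

definition nbh :: "('a, 'b) monoid_scheme \<Rightarrow> 'a \<Rightarrow> 'a set" where
  "nbh G x = {y \<in> carrier G. y \<in> cyc G x \<or> x \<in> cyc G y}"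

locale fin_group = group G for G (structure) +
  assumes fin: "finite (carrier G)"
begin

lemma ord_pos: "x \<in> carrier G \<Longrightarrow> ord x > 0"
  using ord_ge_1[OF fin] by force

lemma cyc_closed: "x \<in> carrier G \<Longrightarrow> y \<in> cyc G x \<Longrightarrow> y \<in> carrier G"
  by (auto simp: cyc_def)

lemma cyc_self: "x \<in> carrier G \<Longrightarrow> x \<in> cyc G x"
  unfolding cyc_def by (metis nat_pow_eone rangeI)

lemma cyc_one: "\<one> \<in> cyc G x"
  unfolding cyc_def by (metis nat_pow_0 rangeI)

lemma cyc_trans: "x \<in> carrier G \<Longrightarrow> y \<in> cyc G x \<Longrightarrow> z \<in> cyc G y \<Longrightarrow> z \<in> cyc G x"
  unfolding cyc_def by (auto simp: nat_pow_pow)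

lemma finite_cyc: "x \<in> carrier G \<Longrightarrow> finite (cyc G x)"
  using fin cyc_closed by (meson finite_subset subsetI)

lemma ord_dvd_of_cyc: "x \<in> carrier G \<Longrightarrow> y \<in> cyc G x \<Longrightarrow> ord y dvd ord x"
  unfolding cyc_def
  by (auto simp: pow_eq_id[symmetric] nat_pow_pow)
    (metis mult.commute nat_pow_one nat_pow_pow pow_ord_eq_1)

text \<open>
  A cyclic group has only one subgroup of each order, so inside it the power relation is
  divisibility of orders. With z = x^j and y = x^k, the order condition says that
  g = gcd k (ord x) divides j, and Bezout's identity makes x^g a power of y.
\<close>

lemma cyc_iff_ord_dvd:
  assumes x: "x \<in> carrier G" and y: "y \<in> cyc G x" and z: "z \<in> cyc G x"
  shows "z \<in> cyc G y \<longleftrightarrow> ord z dvd ord y"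
proof
  have yc: "y \<in> carrier G" using x y by (rule cyc_closed)
  show "z \<in> cyc G y \<Longrightarrow> ord z dvd ord y" by (rule ord_dvd_of_cyc[OF yc])
  assume d: "ord z dvd ord y"
  obtain k where k: "y = x [^] (k::nat)" using y unfolding cyc_def by auto
  obtain j where j: "z = x [^] (j::nat)" using z unfolding cyc_def by auto
  show "z \<in> cyc G y"
  proof (cases "k = 0")
    case True
    then have "ord z dvd 1" using d k by simp
    then have "z = \<one>" using ord_eq_1 x j by simp
    then show ?thesis using cyc_one by simp
  next
    case False
    let ?n = "ord x" and ?g = "gcd k (ord x)"
    have n0: "?n > 0" using x by (rule ord_pos)
    have oy: "ord y = ?n div ?g" using ord_pow_gen[OF x, of k] k False by (simp add: gcd.commute)
    have "z [^] ord y = \<one>" using d x j by (simp add: pow_eq_id)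
    then have "?n dvd j * ord y" using x j by (simp add: nat_pow_pow pow_eq_id)
    then have "(?n div ?g) * ?g dvd (?n div ?g) * j" using oy by (simp add: mult.commute)
    moreover have "?n div ?g > 0" using n0 by (simp add: div_greater_zero_iff dvd_imp_le)
    ultimately have "?g dvd j" by (rule dvd_mult_cancel)
    then obtain i where i: "j = ?g * i" by blast
    obtain a b where ab: "a * k = b * ?n + ?g"
      using bezout_nat[OF False, of ?n] by (metis mult.commute)
    have "x [^] (b * ?n) = \<one>" using x by (simp add: pow_eq_id)
    then have "x [^] (a * k) = x [^] ?g"
      unfolding ab using x by (simp add: nat_pow_mult[symmetric])
    have "z = (x [^] ?g) [^] i" using x j i by (simp add: nat_pow_pow)
    also have "\<dots> = (x [^] (a * k)) [^] i" using \<open>x [^] (a * k) = x [^] ?g\<close> by simp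
    also have "\<dots> = y [^] (a * i)" using x k by (simp add: nat_pow_pow ac_simps)
    finally have "z = y [^] (a * i)" .
    then show ?thesis by (simp add: cyc_def)
  qed
qed

lemma card_cyc: assumes x: "x \<in> carrier G" shows "card (cyc G x) = ord x"
proof -
  have "cyc G x = (\<lambda>k. x [^] k) ` {0 .. ord x - 1}"
    using ord_elems[OF fin x] unfolding cyc_def by (auto simp: full_SetCompr_eq Setcompr_eq_image)
  then show ?thesis using card_image[OF ord_inj[OF x]] ord_pos[OF x] by simp
qed

lemma exists_ord_in_cyc:
  assumes x: "x \<in> carrier G" and d: "d dvd ord x"
  shows "\<exists>y \<in> cyc G x. ord y = d"
proof -
  obtain e where e: "ord x = e * d" using d by (metis dvdE mult.commute)
  then have "e \<noteq> 0" "d \<noteq> 0" using ord_pos[OF x] by auto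
  then have "ord (x [^] e) = d" using ord_pow[OF x, of e] e by simp
  then show ?thesis unfolding cyc_def by blast
qed

lemma card_generators:
  assumes x: "x \<in> carrier G"
  shows "card {z \<in> cyc G x. ord z = ord x} = totient (ord x)"
proof -
  let ?n = "ord x"
  have n0: "?n > 0" using x by (rule ord_pos)
  have "{z \<in> cyc G x. ord z = ?n} = (\<lambda>k. x [^] k) ` totatives ?n"
  proof (intro equalityI subsetI)
    fix z assume "z \<in> {z \<in> cyc G x. ord z = ?n}"
    then have z: "z \<in> cyc G x" "ord z = ?n" by auto
    then obtain k where "z = x [^] (k::nat)" unfolding cyc_def by auto
    define k' where "k' = k mod ?n"
    have "x [^] k = x [^] (?n * (k div ?n)) \<otimes> x [^] k'"
      unfolding k'_def using x by (simp add: nat_pow_mult)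
    moreover have "x [^] (?n * (k div ?n)) = \<one>" using x by (simp add: pow_eq_id)
    ultimately have "x [^] k = x [^] k'" using x by simp
    then have zk: "z = x [^] k'" using \<open>z = x [^] k\<close> by simp
    show "z \<in> (\<lambda>k. x [^] k) ` totatives ?n"
    proof (cases "k' = 0")
      case True
      then have "?n = 1" using zk z(2) by simp
      then have "x = \<one>" using x ord_eq_1 by blast
      then show ?thesis using zk True by (intro image_eqI[of _ _ 1]) auto
    next
      case False
      then have "?n div gcd ?n k' = ?n" using ord_pow_gen[OF x, of k'] zk z(2) by simp
      then have "gcd k' ?n = 1" using n0
        by (simp add: div_eq_dividend_iff gcd.commute)
      moreover have "k' \<le> ?n" using n0 k'_def by (simp add: less_imp_le)
      ultimately show ?thesis using zk False
        by (auto simp: in_totatives_iff coprime_iff_gcd_eq_1)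
    qed
  next
    fix z assume "z \<in> (\<lambda>k. x [^] k) ` totatives ?n"
    then obtain k where "z = x [^] k" "k > 0" "gcd ?n k = 1"
      by (auto simp: in_totatives_iff coprime_iff_gcd_eq_1 gcd.commute)
    then show "z \<in> {z \<in> cyc G x. ord z = ?n}"
      using ord_pow_gen[OF x, of k] by (auto simp: cyc_def)
  qed
  moreover have "inj_on (\<lambda>k. x [^] k) (totatives ?n)"
    by (rule inj_on_subset[OF ord_inj'[OF x]]) (auto simp: in_totatives_iff)
  ultimately show ?thesis by (simp add: card_image totient_def)
qed

lemma card_ord_in_cyc:
  assumes x: "x \<in> carrier G" and d: "d dvd ord x"
  shows "card {z \<in> cyc G x. ord z = d} = totient d"
proof -
  obtain y where y: "y \<in> cyc G x" "ord y = d" using exists_ord_in_cyc[OF assms] by blast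
  have yc: "y \<in> carrier G" using x y(1) by (rule cyc_closed)
  have "{z \<in> cyc G x. ord z = d} = {z \<in> cyc G y. ord z = ord y}"
    using y cyc_iff_ord_dvd[OF x y(1)] cyc_trans[OF x y(1)] by auto
  then show ?thesis using card_generators[OF yc] y(2) by simp
qed

lemma nbhI1: "x \<in> carrier G \<Longrightarrow> y \<in> cyc G x \<Longrightarrow> y \<in> nbh G x"
  by (auto simp: nbh_def intro: cyc_closed)

lemma nbhI2: "x \<in> carrier G \<Longrightarrow> y \<in> cyc G x \<Longrightarrow> x \<in> nbh G y"
  by (auto simp: nbh_def)

lemma nbh_sym: "x \<in> carrier G \<Longrightarrow> y \<in> nbh G x \<Longrightarrow> x \<in> nbh G y"
  by (auto simp: nbh_def)

lemma nbh_self: "x \<in> carrier G \<Longrightarrow> x \<in> nbh G x"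
  by (simp add: nbhI1 cyc_self)

lemma nbh_one: "nbh G \<one> = carrier G"
  by (auto simp: nbh_def cyc_one)

lemma nbh_ord: "x \<in> carrier G \<Longrightarrow> y \<in> nbh G x \<Longrightarrow> ord y dvd ord x \<or> ord x dvd ord y"
  by (auto simp: nbh_def ord_dvd_of_cyc)

lemma same_ord_cyc:
  assumes "x \<in> carrier G" "y \<in> cyc G x" "ord y = ord x"
  shows "x \<in> cyc G y"
  using cyc_iff_ord_dvd[OF assms(1,2) cyc_self[OF assms(1)]] assms(3) by simp

lemma nbh_same_cyc:
  assumes "x \<in> carrier G" "y \<in> cyc G x" "x \<in> cyc G y"
  shows "nbh G y = nbh G x"
proof -
  have y: "y \<in> carrier G" using assms(1,2) by (rule cyc_closed)
  have "cyc G y = cyc G x"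
    using cyc_trans[OF assms(1,2)] cyc_trans[OF y assms(3)] by blast
  moreover have "y \<in> cyc G v \<longleftrightarrow> x \<in> cyc G v" if "v \<in> carrier G" for v
    using cyc_trans[OF that _ assms(2)] cyc_trans[OF that _ assms(3)] by blast
  ultimately show ?thesis unfolding nbh_def by blast
qed

lemma nbh_same_ord:
  assumes "x \<in> carrier G" "y \<in> cyc G x" "ord y = ord x"
  shows "nbh G y = nbh G x"
  by (rule nbh_same_cyc[OF assms(1,2) same_ord_cyc[OF assms]])

section \<open>Twin classes\<close>

text \<open>
  An element of order d, for a divisor d of the order of x that is incomparable with the order of
  y, would be adjacent to x but not to y.
\<close>

lemma twin_prime_power:
  assumes x: "x \<in> carrier G" and y: "y \<in> cyc G x" "y \<noteq> \<one>" "ord y \<noteq> ord x"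
    and eq: "nbh G y = nbh G x"
  shows "prime_power_or_1 (ord x)"
proof (rule ccontr)
  assume np: "\<not> prime_power_or_1 (ord x)"
  have yc: "y \<in> carrier G" using x y(1) by (rule cyc_closed)
  have "ord y \<noteq> 1" using y(2) yc ord_eq_1 by blast
  then obtain d where d: "d dvd ord x" "\<not> d dvd ord y" "\<not> ord y dvd d"
    using incomparable_divisor[OF ord_pos[OF x] ord_dvd_of_cyc[OF x y(1)] y(3)] np by blast
  obtain z where z: "z \<in> cyc G x" "ord z = d" using exists_ord_in_cyc[OF x d(1)] by blast
  have "z \<in> nbh G y" using nbhI1[OF x z(1)] eq by simp
  then show False using nbh_ord[OF yc] z(2) d by blast
qed

lemma cyc_prime_power_comparable:
  assumes "x \<in> carrier G" "prime_power_or_1 (ord x)" "y \<in> cyc G x" "z \<in> cyc G x"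
  shows "z \<in> nbh G y"
  using prime_power_divisors_comparable[OF assms(2) ord_dvd_of_cyc[OF assms(1,3)] ord_dvd_of_cyc[OF assms(1,4)]]
    cyc_iff_ord_dvd[OF assms(1,3,4)] cyc_iff_ord_dvd[OF assms(1,4,3)] cyc_closed[OF assms(1,4)]
  by (auto simp: nbh_def)

lemma twin_between_prime_power:
  assumes x: "x \<in> carrier G" "prime_power_or_1 (ord x)" and w: "w \<in> cyc G x" and y: "y \<in> cyc G w"
    and eq: "nbh G y = nbh G x"
  shows "nbh G w = nbh G x"
proof (intro equalityI subsetI)
  have wc: "w \<in> carrier G" using x(1) w by (rule cyc_closed)
  fix v
  { assume v: "v \<in> nbh G w"
    then have "v \<in> carrier G" by (simp add: nbh_def)
    then show "v \<in> nbh G x"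
      using v x(1) w y eq cyc_trans nbhI1 nbhI2 unfolding nbh_def[of G w] by blast }
  { assume v: "v \<in> nbh G x"
    then have vc: "v \<in> carrier G" by (simp add: nbh_def)
    from v consider "v \<in> cyc G x" | "x \<in> cyc G v" by (auto simp: nbh_def)
    then show "v \<in> nbh G w"
    proof cases
      case 1
      then show ?thesis using cyc_prime_power_comparable x w by blast
    next
      case 2
      then show ?thesis using cyc_trans vc w nbhI2 by blast
    qed }
qed

text \<open>
  Twin classes are convex for the power relation, apart from the class of the identity: in a cyclic
  group of order 6 the generators are twins of the identity, the other elements between are not.
\<close>

lemma twin_between:
  assumes x: "x \<in> carrier G" and w: "w \<in> cyc G x" and y: "y \<in> cyc G w" "y \<noteq> \<one>"
    and eq: "nbh G y = nbh G x"
  shows "nbh G w = nbh G x"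
proof (cases "ord y = ord x")
  case True
  have wc: "w \<in> carrier G" using x w by (rule cyc_closed)
  have "x \<in> cyc G y" using same_ord_cyc[OF x cyc_trans[OF x w y(1)] True] .
  then have "x \<in> cyc G w" using cyc_trans[OF wc y(1)] by blast
  then show ?thesis using nbh_same_cyc x w by blast
next
  case False
  then show ?thesis using twin_prime_power[OF x cyc_trans[OF x w y(1)] y(2) False eq]
    twin_between_prime_power x w y(1) eq by blast
qed

definition twins :: "'a \<Rightarrow> 'a set" where
  "twins x = {z \<in> carrier G. nbh G z = nbh G x}"

lemma finite_twins: "finite (twins x)"
  using fin by (auto simp: twins_def)

lemma exists_max_twin:
  assumes "x \<in> carrier G"
  shows "\<exists>w \<in> twins x. twins x \<subseteq> cyc G w \<and> (\<forall>z \<in> twins x. ord z \<le> ord w)"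
proof -
  let ?M = "Max (ord ` twins x)"
  have ne: "ord ` twins x \<noteq> {}" and fi: "finite (ord ` twins x)"
    using assms finite_twins by (auto simp: twins_def)
  obtain w where w: "w \<in> twins x" "ord w = ?M" using Max_in[OF fi ne] by auto
  have le: "ord z \<le> ord w" if "z \<in> twins x" for z
    using that w(2) fi by simp
  have "z \<in> cyc G w" if z: "z \<in> twins x" for z
  proof -
    have c: "z \<in> carrier G" "w \<in> carrier G" using z w by (auto simp: twins_def)
    have "z \<in> nbh G w" using z w nbh_self[OF c(1)] by (simp add: twins_def)
    then consider "z \<in> cyc G w" | "w \<in> cyc G z" by (auto simp: nbh_def)
    then show ?thesis
    proof cases
      case 2
      then have "ord w dvd ord z" using c ord_dvd_of_cyc by blast
      then have "ord w = ord z" using le[OF z] ord_pos[OF c(1)] dvd_imp_le le_antisym by blast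
      then show ?thesis using same_ord_cyc c 2 by blast
    qed
  qed
  then show ?thesis using w(1) le by blast
qed

lemma totient_le_card_twins:
  assumes x: "x \<in> carrier G"
  shows "totient (ord x) \<le> card (twins x)"
proof -
  have "{z \<in> cyc G x. ord z = ord x} \<subseteq> twins x"
    using nbh_same_ord[OF x] cyc_closed[OF x] by (auto simp: twins_def)
  then show ?thesis using card_generators[OF x] card_mono[OF finite_twins] by metis
qed

lemma twins_of_one_order:
  assumes y: "y \<in> carrier G" and same: "\<And>z. z \<in> twins y \<Longrightarrow> ord z = ord y"
  shows "card (twins y) = totient (ord y)"
proof -
  have "twins y \<subseteq> {z \<in> cyc G y. ord z = ord y}"
  proof
    fix z assume z: "z \<in> twins y"
    then have zc: "z \<in> carrier G" and "nbh G z = nbh G y" by (auto simp: twins_def)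
    then have "z \<in> nbh G y" using nbh_self by metis
    then consider "z \<in> cyc G y" | "y \<in> cyc G z" by (auto simp: nbh_def)
    then have "z \<in> cyc G y" using same_ord_cyc[OF zc, of y] same[OF z] by cases auto
    then show "z \<in> {z \<in> cyc G y. ord z = ord y}" using same[OF z] by simp
  qed
  then have "card (twins y) \<le> totient (ord y)"
    using card_generators[OF y] card_mono[of "{z \<in> cyc G y. ord z = ord y}"] finite_cyc[OF y] by fastforce
  then show ?thesis using totient_le_card_twins[OF y] by simp
qed

text \<open>
  If all twins of y have the same order, they are the generators of its cyclic group. The class of
  x contains at least its own generators, so totients can be compared. Otherwise the class
  of y contains elements w and u of different orders with u a power of w, so the order of w is a
  power of a prime p, and w is a power of x. The order of x is then also a power of p: for another
  prime divisor q, an element of order q * ord u would be adjacent to u but not to its twin w. So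
  the cyclic group of x has at least as many generators as w has powers, and the class of y is
  smaller still because it omits the identity, which is a power of w.
\<close>

lemma card_twins_below:
  assumes x: "x \<in> carrier G" and y: "y \<in> cyc G x"
    and ne: "nbh G y \<noteq> nbh G x" and nonstar: "nbh G y \<noteq> carrier G"
  shows "card (twins y) < card (twins x) \<or>
    (card (twins y) = card (twins x) \<and> ord x = 2 * ord y \<and> odd (ord y))"
proof (cases "\<forall>z \<in> twins y. ord z = ord y")
  case True
  have yc: "y \<in> carrier G" using x y by (rule cyc_closed)
  have t: "card (twins y) = totient (ord y)" using twins_of_one_order[OF yc] True by blast
  have d: "ord y dvd ord x" using x y by (rule ord_dvd_of_cyc)
  have "ord x \<noteq> ord y" using nbh_same_ord[OF x y] ne by auto
  then show ?thesis
    using totient_dvd_eqD[OF ord_pos[OF x] d] totient_dvd_mono[OF d ord_pos[OF x]] t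
      totient_le_card_twins[OF x] by (cases "totient (ord y) = totient (ord x)") auto
next
  case False
  have yc: "y \<in> carrier G" using x y by (rule cyc_closed)
  have y1: "y \<noteq> \<one>" using nonstar nbh_one by auto
  obtain w where w: "w \<in> twins y" "twins y \<subseteq> cyc G w" using exists_max_twin[OF yc] by blast
  have wc: "w \<in> carrier G" and wn: "nbh G w = nbh G y" using w by (auto simp: twins_def)
  have ytw: "y \<in> twins y" using yc by (simp add: twins_def)
  obtain u where u: "u \<in> twins y" "ord u \<noteq> ord w" using False ytw by metis
  have uc: "u \<in> carrier G" and un: "nbh G u = nbh G w" and uw: "u \<in> cyc G w"
    using u w wn by (auto simp: twins_def)
  have u1: "u \<noteq> \<one>" using un wn nonstar nbh_one by auto
  have ppw: "prime_power_or_1 (ord w)" using twin_prime_power[OF wc uw u1 u(2) un] .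
  have "x \<in> nbh G w" using nbhI2[OF x y] wn by simp
  moreover have xw: "x \<notin> cyc G w"
  proof
    assume "x \<in> cyc G w"
    then have "nbh G x = nbh G w" using twin_between[OF wc _ y y1] wn by simp
    then show False using wn ne by simp
  qed
  ultimately have wx: "w \<in> cyc G x" by (auto simp: nbh_def)
  have oneq: "ord w \<noteq> ord x" using same_ord_cyc[OF x wx] xw by blast
  have dwx: "ord w dvd ord x" using x wx by (rule ord_dvd_of_cyc)
  have duw: "ord u dvd ord w" using wc uw by (rule ord_dvd_of_cyc)
  have "prime_power_or_1 (ord x)"
  proof (rule ccontr)
    assume np: "\<not> prime_power_or_1 (ord x)"
    obtain p r where p: "prime p" "ord w = p ^ r" using ppw unfolding prime_power_or_1_def by blast
    obtain q where q: "prime q" "q dvd ord x" "q \<noteq> p"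
      using other_prime_divisor[OF p(1) ord_pos[OF x] np] by blast
    have cop: "coprime (ord w) q" using p q by (simp add: primes_coprime)
    have copu: "coprime (ord u) q" by (rule coprime_divisors[OF duw dvd_refl cop])
    have "ord u * q dvd ord x"
      using dvd_trans[OF duw dwx] q(2) copu by (rule divides_mult)
    then obtain v where v: "v \<in> cyc G x" "ord v = ord u * q" using exists_ord_in_cyc[OF x] by blast
    have vc: "v \<in> carrier G" using x v(1) by (rule cyc_closed)
    have "u \<in> cyc G v" using cyc_iff_ord_dvd[OF x v(1) cyc_trans[OF x wx uw]] v(2) by simp
    then have "v \<in> nbh G w" using nbhI2[OF vc, of u] un by simp
    then consider "ord u * q dvd ord w" | "ord w dvd ord u * q"
      using nbh_ord[OF wc, of v] unfolding v(2) by blast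
    then show False
    proof cases
      case 1
      then have "q dvd ord w" by (rule dvd_mult_right)
      then show False using cop q(1) by (metis coprime_common_divisor dvd_refl not_prime_unit)
    next
      case 2
      then have "ord w dvd ord u" using cop by (simp add: coprime_dvd_mult_left_iff)
      then show False using duw u(2) dvd_antisym by blast
    qed
  qed
  then have "ord w \<le> totient (ord x)" using totient_prime_power_ge dwx oneq by blast
  moreover have "card (twins y) < ord w"
  proof -
    have "\<one> \<notin> twins y" using nonstar nbh_one by (auto simp: twins_def)
    then have "twins y \<subset> cyc G w" using w(2) cyc_one by blast
    then show ?thesis using psubset_card_mono[OF finite_cyc[OF wc]] card_cyc[OF wc] by simp
  qed
  ultimately show ?thesis using totient_le_card_twins[OF x] by linarith
qed

lemma inv_in_cyc: assumes "x \<in> carrier G" shows "inv x \<in> cyc G x"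
proof -
  have "x [^] (ord x - 1) \<otimes> x = x [^] (Suc (ord x - 1))" by simp
  also have "\<dots> = \<one>" using assms ord_pos[OF assms] by (metis Suc_diff_1 pow_ord_eq_1)
  finally have "inv x = x [^] (ord x - 1)" using assms by (intro inv_equality) auto
  then show ?thesis by (simp add: cyc_def)
qed

lemma unique_involution:
  assumes "x \<in> carrier G" "a \<in> cyc G x" "b \<in> cyc G x" "ord a = 2" "ord b = 2"
  shows "a = b"
proof -
  have "2 dvd ord x" using ord_dvd_of_cyc[OF assms(1,2)] assms(4) by simp
  then have "card {z \<in> cyc G x. ord z = 2} = 1" using card_ord_in_cyc[OF assms(1), of 2] by simp
  then obtain c where "{z \<in> cyc G x. ord z = 2} = {c}" by (rule card_1_singletonE)
  moreover have "a \<in> {z \<in> cyc G x. ord z = 2}" "b \<in> {z \<in> cyc G x. ord z = 2}"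
    using assms by simp_all
  ultimately show ?thesis by simp
qed

section \<open>Elements adjacent to all others\<close>

definition stars :: "'a set" where "stars = {x \<in> carrier G. nbh G x = carrier G}"

text \<open>
  The name refers to the consequence that every star is a power of every element that is not a
  star, see star_below.
\<close>

definition stars_low :: bool where
  "stars_low \<longleftrightarrow> (\<exists>x \<in> carrier G. prime_power_or_1 (ord x) \<and> stars = cyc G x)"

text \<open>
  Let x be a star of maximal order. If its order is a prime power, all its powers are stars. If
  not, and y lies outside the group generated by x, then x is a power of y, and the order of y has
  a divisor incomparable with the order of x; an element of that order is not adjacent to x.
\<close>

lemma stars_dichotomy:
  "(\<exists>x \<in> carrier G. cyc G x = carrier G \<and> \<not> prime_power_or_1 (ord x)) \<or> stars_low"
proof -
  have st: "stars = twins \<one>" by (auto simp: stars_def twins_def nbh_one)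
  obtain x where x: "x \<in> stars" "stars \<subseteq> cyc G x"
    using exists_max_twin[of \<one>] st by auto
  have xc: "x \<in> carrier G" and xn: "nbh G x = carrier G" using x by (auto simp: stars_def)
  show ?thesis
  proof (cases "prime_power_or_1 (ord x)")
    case True
    have "nbh G z = carrier G" if z: "z \<in> cyc G x" for z
      using twin_between_prime_power[OF xc True z cyc_one] xn nbh_one by simp
    then have "stars = cyc G x" using x(2) cyc_closed[OF xc] by (auto simp: stars_def)
    then show ?thesis using True xc stars_low_def by blast
  next
    case False
    have "carrier G \<subseteq> cyc G x"
    proof (rule ccontr)
      assume "\<not> carrier G \<subseteq> cyc G x"
      then obtain y where y: "y \<in> carrier G" "y \<notin> cyc G x" by blast
      then have xy: "x \<in> cyc G y" using xn by (auto simp: nbh_def)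
      have "ord x \<noteq> ord y" using same_ord_cyc[OF y(1) xy] y(2) by blast
      then obtain d where d: "d dvd ord y" "\<not> d dvd ord x" "\<not> ord x dvd d"
        using incomparable_divisor[OF ord_pos[OF y(1)] ord_dvd_of_cyc[OF y(1) xy]] False by blast
      obtain v where v: "v \<in> cyc G y" "ord v = d" using exists_ord_in_cyc[OF y(1) d(1)] by blast
      have "v \<in> nbh G x" using xn cyc_closed[OF y(1) v(1)] by simp
      then show False using nbh_ord[OF xc] d v(2) by blast
    qed
    then show ?thesis using False xc cyc_closed[OF xc] by blast
  qed
qed

lemma star_below:
  assumes low: stars_low and s: "s \<in> stars" and y: "y \<in> carrier G" "y \<notin> stars"
  shows "s \<in> cyc G y" and "y \<notin> cyc G s"
proof -
  obtain x where x: "x \<in> carrier G" "stars = cyc G x" using low by (auto simp: stars_low_def)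
  show "y \<notin> cyc G s" using cyc_trans[OF x(1), of s y] s y(2) x(2) by blast
  moreover have "y \<in> nbh G s" using s y(1) by (simp add: stars_def)
  ultimately show "s \<in> cyc G y" by (simp add: nbh_def)
qed

lemma twin_between_stars_low:
  assumes low: stars_low and x: "x \<in> carrier G" and w: "w \<in> cyc G x" and y: "y \<in> cyc G w"
    and eq: "nbh G y = nbh G x"
  shows "nbh G w = nbh G x"
proof (cases "y = \<one>")
  case True
  then have "x \<in> stars" using x eq nbh_one by (simp add: stars_def)
  moreover have "w \<in> carrier G" using x w by (rule cyc_closed)
  ultimately have "w \<in> stars" using star_below(2)[OF low] w by blast
  then show ?thesis using \<open>x \<in> stars\<close> by (simp add: stars_def)
qed (use twin_between[OF x w y _ eq] in blast)

text \<open>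
  By convexity, arcs between two different twin classes all point the same way.
\<close>

lemma cyc_twins_constant:
  assumes low: stars_low and x: "x \<in> carrier G" and y: "y \<in> cyc G x" and ne: "nbh G x \<noteq> nbh G y"
    and x': "x' \<in> carrier G" "nbh G x' = nbh G x" and y': "y' \<in> carrier G" "nbh G y' = nbh G y"
  shows "y' \<in> cyc G x'"
proof -
  have yc: "y \<in> carrier G" using x y by (rule cyc_closed)
  have "x' \<in> nbh G y" using nbhI1[OF x y] x' nbh_sym by blast
  moreover have "x' \<notin> cyc G y"
    using twin_between_stars_low[OF low x y _ x'(2)] ne by metis
  ultimately have yx': "y \<in> cyc G x'" by (simp add: nbh_def)
  have "y' \<in> nbh G x'" using nbhI2[OF x'(1) yx'] y' nbh_sym[OF y'(1)] by simp
  moreover have "x' \<notin> cyc G y'"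
    using twin_between_stars_low[OF low y'(1) _ yx'] y'(2) x'(2) ne by metis
  ultimately show ?thesis by (simp add: nbh_def)
qed

text \<open>
  This form treats all classes alike: m is the order of w when all twins have the same order, and
  m is 1 for the class of the stars.
\<close>

lemma twins_upward_closed:
  assumes low: stars_low and w: "w \<in> carrier G" "twins w \<subseteq> cyc G w"
  shows "\<exists>m. twins w = {z \<in> cyc G w. m \<le> ord z}"
proof -
  let ?m = "Min (ord ` twins w)"
  have ne: "ord ` twins w \<noteq> {}" and fi: "finite (ord ` twins w)"
    using w finite_twins by (auto simp: twins_def)
  obtain u where u: "u \<in> twins w" "ord u = ?m" using Min_in[OF fi ne] by auto
  have uc: "u \<in> carrier G" and un: "nbh G u = nbh G w" and uw: "u \<in> cyc G w"
    using u w by (auto simp: twins_def)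
  have "z \<in> twins w" if z: "z \<in> cyc G w" "?m \<le> ord z" for z
  proof -
    have zc: "z \<in> carrier G" using w(1) z(1) by (rule cyc_closed)
    have "nbh G z = nbh G w"
    proof (cases "u = \<one> \<or> ord u = ord w")
      case True
      then show ?thesis
      proof
        assume "u = \<one>"
        then show ?thesis using twin_between_stars_low[OF low w(1) z(1) cyc_one] un by simp
      next
        assume "ord u = ord w"
        then have "ord z = ord w"
          using z(2) u(2) dvd_imp_le[OF ord_dvd_of_cyc[OF w(1) z(1)] ord_pos[OF w(1)]] by simp
        then show ?thesis by (rule nbh_same_ord[OF w(1) z(1)])
      qed
    next
      case False
      then have pp: "prime_power_or_1 (ord w)"
        using twin_prime_power[OF w(1) uw _ _ un] by blast
      have "ord u dvd ord z"
        using prime_power_divisors_comparable[OF pp ord_dvd_of_cyc[OF w(1) uw] ord_dvd_of_cyc[OF w(1) z(1)]]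
          z(2) u(2) dvd_imp_le[OF _ ord_pos[OF uc], of "ord z"] by (metis le_antisym)
      then have "u \<in> cyc G z" using cyc_iff_ord_dvd[OF w(1) z(1) uw] by simp
      then show ?thesis using twin_between_stars_low[OF low w(1) z(1) _ un] by blast
    qed
    then show ?thesis using zc by (simp add: twins_def)
  qed
  then have "twins w = {z \<in> cyc G w. ?m \<le> ord z}" using w(2) fi by auto
  then show ?thesis by blast
qed

lemma card_upper_part:
  assumes w: "w \<in> carrier G"
  shows "card {z \<in> cyc G w. m \<le> ord z} = (\<Sum>k | k dvd ord w \<and> m \<le> k. totient k)"
    and "card {z \<in> {z \<in> cyc G w. m \<le> ord z}. ord z = k} = (if k dvd ord w \<and> m \<le> k then totient k else 0)"
proof -
  have fin_div: "finite {k. k dvd ord w \<and> m \<le> k}" using ord_pos[OF w] by simp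
  have "{z \<in> cyc G w. m \<le> ord z} = (\<Union>k \<in> {k. k dvd ord w \<and> m \<le> k}. {z \<in> cyc G w. ord z = k})"
    using ord_dvd_of_cyc[OF w] by auto
  also have "card \<dots> = (\<Sum>k | k dvd ord w \<and> m \<le> k. card {z \<in> cyc G w. ord z = k})"
    using fin_div finite_cyc[OF w] by (intro card_UN_disjoint) auto
  also have "\<dots> = (\<Sum>k | k dvd ord w \<and> m \<le> k. totient k)"
    using card_ord_in_cyc[OF w] by (intro sum.cong) auto
  finally show "card {z \<in> cyc G w. m \<le> ord z} = (\<Sum>k | k dvd ord w \<and> m \<le> k. totient k)" .
  show "card {z \<in> {z \<in> cyc G w. m \<le> ord z}. ord z = k} = (if k dvd ord w \<and> m \<le> k then totient k else 0)"
  proof (cases "k dvd ord w \<and> m \<le> k")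
    case True
    then have "{z \<in> {z \<in> cyc G w. m \<le> ord z}. ord z = k} = {z \<in> cyc G w. ord z = k}" by auto
    then show ?thesis using True card_ord_in_cyc[OF w, of k] by simp
  next
    case False
    then have "{z \<in> {z \<in> cyc G w. m \<le> ord z}. ord z = k} = {}"
      using ord_dvd_of_cyc[OF w] by auto
    then show ?thesis by (simp only: False if_False card.empty)
  qed
qed

lemma twins_cyc_iff_ord_dvd:
  assumes "x \<in> carrier G" "y \<in> twins x"
  shows "y \<in> cyc G x \<longleftrightarrow> ord y dvd ord x"
proof -
  obtain w where w: "w \<in> twins x" "twins x \<subseteq> cyc G w" using exists_max_twin[OF assms(1)] by blast
  have "w \<in> carrier G" "x \<in> twins x" using w assms by (auto simp: twins_def)
  then show ?thesis using cyc_iff_ord_dvd w assms by blast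
qed

lemma cauchy:
  assumes q: "prime q" "q dvd card (carrier G)"
  shows "\<exists>y \<in> carrier G. ord y = q"
proof -
  obtain m where "order G = q ^ 1 * m" using q(2) by (auto simp: order_def)
  then obtain K where K: "subgroup K G" "card K = q ^ 1"
    using sylow_thm[OF q(1) is_group _ fin] by blast
  have "K \<noteq> {\<one>}" using K(2) q(1) by (metis One_nat_def card_1_singleton_iff not_prime_1 power_one_right)
  then obtain y where y: "y \<in> K" "y \<noteq> \<one>" using subgroup.one_closed[OF K(1)] by blast
  have yc: "y \<in> carrier G" using subgroup.mem_carrier[OF K(1)] y(1) .
  have cK: "card K = q" using K(2) by simp
  have fK: "finite K" using subgroup.subset[OF K(1)] fin by (rule finite_subset)
  interpret K: group "G\<lparr>carrier := K\<rparr>" using subgroup.subgroup_is_group[OF K(1) is_group] .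
  have "y [^]\<^bsub>G\<lparr>carrier := K\<rparr>\<^esub> order (G\<lparr>carrier := K\<rparr>) = \<one>\<^bsub>G\<lparr>carrier := K\<rparr>\<^esub>"
    using y(1) by (intro K.pow_order_eq_1) simp
  then have "y [^] q = \<one>" using cK by (simp add: order_def nat_pow_consistent[symmetric])
  then have "ord y dvd q" using yc by (simp add: pow_eq_id)
  moreover have "ord y \<noteq> 1" using ord_eq_1 yc y(2) by blast
  ultimately have "ord y = q" using q(1) prime_nat_iff by blast
  then show ?thesis using yc by blast
qed

end

lemma sum_eq_imp_nested_eq:
  fixes f :: "'a \<Rightarrow> nat"
  assumes "finite B" "A \<subseteq> B" "sum f A = sum f B" "\<And>x. x \<in> B \<Longrightarrow> f x > 0"
  shows "A = B"
proof (rule ccontr)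
  assume "A \<noteq> B"
  then obtain b where "b \<in> B - A" using assms(2) by blast
  then have "sum f A < sum f B" using assms by (intro sum_strict_mono2[of B A b]) auto
  then show False using assms(3) by simp
qed

text \<open>
  Applied below with the order as g and h, or with the pair of twin class and order.
\<close>

lemma bij_betw_of_equal_fibre_cards:
  assumes fin: "finite V" and eq: "\<And>k. card {x \<in> V. g x = k} = card {x \<in> V. h x = k}"
  shows "\<exists>f. bij_betw f V V \<and> (\<forall>x \<in> V. h (f x) = g x)"
proof -
  have "\<exists>f. bij_betw f {x \<in> V. g x = k} {x \<in> V. h x = k}" for k
    using fin eq[of k] by (intro finite_same_card_bij) auto
  then obtain F where F: "\<And>k. bij_betw (F k) {x \<in> V. g x = k} {x \<in> V. h x = k}" by metis
  define f where "f x = F (g x) x" for x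
  have f: "f x \<in> V \<and> h (f x) = g x" if "x \<in> V" for x
    using bij_betwE[OF F[of "g x"]] that by (auto simp: f_def)
  have "inj_on f V"
  proof (rule inj_onI)
    fix x y assume xy: "x \<in> V" "y \<in> V" "f x = f y"
    then have "g x = g y" using f by metis
    then show "x = y" using xy bij_betw_imp_inj_on[OF F[of "g x"]]
      by (auto simp: f_def dest: inj_onD)
  qed
  then have "bij_betw f V V" using endo_inj_surj[OF fin] f by (auto simp: bij_betw_def)
  then show ?thesis using f by blast
qed

section \<open>Two groups with the same power graph\<close>

text \<open>
  Equal closed neighbourhoods are what it means to have the same power graph. Both groups live on
  the same set, so that no bijection between vertex sets has to be carried along.
\<close>

locale two_groups = G: fin_group G + H: fin_group H
  for G :: "('a, 'b) monoid_scheme" and H :: "('a, 'c) monoid_scheme" +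
  assumes carrier_eq: "carrier H = carrier G"
    and nbh_eq: "\<And>x. x \<in> carrier G \<Longrightarrow> nbh H x = nbh G x"
begin

lemma swap: "two_groups H G"
  using nbh_eq carrier_eq
  by (simp add: two_groups_def two_groups_axioms_def G.fin_group_axioms H.fin_group_axioms)

lemma twins_eq: "x \<in> carrier G \<Longrightarrow> H.twins x = G.twins x"
  using nbh_eq carrier_eq by (auto simp: H.twins_def G.twins_def)

lemma stars_eq: "H.stars = G.stars"
  using nbh_eq carrier_eq by (auto simp: H.stars_def G.stars_def)

text \<open>
  Comparing the sizes of the two classes in both groups leaves only the case that the order of x
  in G is twice the odd order of y, and the order of y in H is twice the odd order of x. Let t be
  the involution of G among the powers of x. It is not adjacent to y, so in H it cannot be a power
  of x, and x is a power of t. Hence t has order at least 3 in H, and its inverse t' in H is a twin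
  of t different from t. In G this t' must lie strictly above t. It cannot lie above x, because it
  would then be adjacent to y. So it is a power of x of order 2 * e with e > 1 odd, and its power of
  order e is adjacent to t' but not to t.
\<close>

lemma directions_not_opposite:
  assumes x: "x \<in> carrier G" "nbh G x \<noteq> carrier G" and y: "y \<in> carrier G" "nbh G y \<noteq> carrier G"
    and ne: "nbh G y \<noteq> nbh G x"
    and yx: "y \<in> cyc G x" and xy: "x \<in> cyc H y"
  shows False
proof -
  have xH: "x \<in> carrier H" and yH: "y \<in> carrier H" using x y carrier_eq by auto
  have neH: "nbh H x \<noteq> nbh H y" "nbh H x \<noteq> carrier H" using ne x y nbh_eq carrier_eq by auto
  from G.card_twins_below[OF x(1) yx ne y(2)] H.card_twins_below[OF yH xy neH]
  have oG: "group.ord G x = 2 * group.ord G y" "odd (group.ord G y)"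
    and oH: "group.ord H y = 2 * group.ord H x" "odd (group.ord H x)"
    unfolding twins_eq[OF x(1)] twins_eq[OF y(1)] by auto
  have oy1: "group.ord G y \<noteq> 1" using G.ord_eq_1[OF y(1)] G.nbh_one y(2) by metis
  have ox1: "group.ord H x \<noteq> 1" using H.ord_eq_1[OF xH] H.nbh_one neH(2) by metis
  obtain t where t: "t \<in> cyc G x" "group.ord G t = 2"
    using G.exists_ord_in_cyc[OF x(1), of 2] oG(1) by auto
  have tc: "t \<in> carrier G" using x(1) t(1) by (rule G.cyc_closed)
  then have tH: "t \<in> carrier H" using carrier_eq by simp
  have t_y: "t \<notin> nbh G y"
  proof
    assume "t \<in> nbh G y"
    then have "2 dvd group.ord G y \<or> group.ord G y dvd 2" using G.nbh_ord[OF y(1)] t(2) by metis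
    then show False using oG(2) oy1 by (metis prime_nat_iff two_is_prime_nat dvd_refl)
  qed
  have t_star: "nbh G t \<noteq> carrier G" using t_y y(1) G.nbh_sym[OF tc] by blast
  have "t \<in> nbh H x" using G.nbhI1[OF x(1) t(1)] nbh_eq[OF x(1)] by simp
  moreover have "t \<notin> cyc H x"
  proof
    assume "t \<in> cyc H x"
    then have "t \<in> nbh H y" using H.cyc_trans[OF yH xy] H.nbhI1[OF yH] by blast
    then show False using t_y nbh_eq[OF y(1)] by simp
  qed
  ultimately have xt: "x \<in> cyc H t" by (simp add: nbh_def)
  define t' where "t' = inv\<^bsub>H\<^esub> t"
  have t'H: "t' \<in> carrier H" and ot': "group.ord H t' = group.ord H t" and t'_cyc: "t' \<in> cyc H t"
    using tH H.inv_in_cyc by (auto simp: t'_def)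
  have t'G: "t' \<in> carrier G" using t'H carrier_eq by simp
  have twin: "nbh G t' = nbh G t"
    using H.nbh_same_ord[OF tH t'_cyc ot'] nbh_eq tc t'G by simp
  have "t' \<noteq> t"
  proof
    assume "t' = t"
    then have "t \<otimes>\<^bsub>H\<^esub> t = \<one>\<^bsub>H\<^esub>" using tH H.r_inv[OF tH] by (simp add: t'_def)
    then have "t [^]\<^bsub>H\<^esub> (2::nat) = \<one>\<^bsub>H\<^esub>" using tH by (simp add: numeral_2_eq_2)
    then have "group.ord H t dvd 2" using H.pow_eq_id[OF tH] by blast
    then have "group.ord H x dvd 2" using H.ord_dvd_of_cyc[OF tH xt] dvd_trans by blast
    then show False using oH(2) ox1 by (metis prime_nat_iff two_is_prime_nat dvd_refl)
  qed
  have t't: "t' \<in> nbh G t" using twin G.nbh_self[OF t'G] by simp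
  have not_below: "t' \<notin> cyc G t"
  proof
    assume a: "t' \<in> cyc G t"
    then have "group.ord G t' dvd 2" using G.ord_dvd_of_cyc[OF tc] t(2) by metis
    then have "group.ord G t' = 1 \<or> group.ord G t' = 2" by (metis prime_nat_iff two_is_prime_nat)
    then show False
    proof
      assume "group.ord G t' = 1"
      then have "t' = \<one>\<^bsub>G\<^esub>" using G.ord_eq_1[OF t'G] by blast
      then show False using twin G.nbh_one t_star by simp
    next
      assume "group.ord G t' = 2"
      then show False
        using G.unique_involution[OF tc a G.cyc_self[OF tc]] t(2) \<open>t' \<noteq> t\<close> by blast
    qed
  qed
  then have tt': "t \<in> cyc G t'" using t't by (simp add: nbh_def)
  have "x \<in> nbh G t'" using G.nbhI2[OF x(1) t(1)] twin by simp
  moreover have "x \<notin> cyc G t'"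
  proof
    assume "x \<in> cyc G t'"
    then have "t' \<in> nbh G y" using G.cyc_trans[OF t'G _ yx] G.nbhI2[OF t'G] by blast
    then have "y \<in> nbh G t" using G.nbh_sym[OF y(1)] twin by blast
    then show False using t_y G.nbh_sym[OF tc] by blast
  qed
  ultimately have t'x: "t' \<in> cyc G x" by (simp add: nbh_def)
  obtain e where e: "group.ord G t' = 2 * e" using G.ord_dvd_of_cyc[OF t'G tt'] t(2) by (metis dvdE)
  have "2 * e dvd 2 * group.ord G y" using G.ord_dvd_of_cyc[OF x(1) t'x] e oG(1) by simp
  then have "e dvd group.ord G y" by simp
  then have "odd e" using oG(2) dvd_trans by blast
  have e1: "e \<noteq> 1"
  proof
    assume "e = 1"
    then show False using G.unique_involution[OF x(1) t'x t(1)] e t(2) \<open>t' \<noteq> t\<close> by simp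
  qed
  obtain v where v: "v \<in> cyc G t'" "group.ord G v = e"
    using G.exists_ord_in_cyc[OF t'G, of e] e by auto
  have "v \<in> nbh G t" using G.nbhI1[OF t'G v(1)] twin by simp
  then have "e dvd 2 \<or> 2 dvd e" using G.nbh_ord[OF tc] v(2) t(2) by metis
  then show False using \<open>odd e\<close> e1 by (metis prime_nat_iff two_is_prime_nat dvd_refl)
qed

lemma direction_transfer:
  assumes low: G.stars_low H.stars_low and x: "x \<in> carrier G" and yx: "y \<in> cyc G x"
    and ne: "nbh G y \<noteq> nbh G x"
  shows "y \<in> cyc H x"
proof (rule ccontr)
  assume no: "y \<notin> cyc H x"
  have y: "y \<in> carrier G" using x yx by (rule G.cyc_closed)
  have "y \<in> nbh H x" using G.nbhI1[OF x yx] nbh_eq[OF x] by simp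
  then have xy: "x \<in> cyc H y" using no by (simp add: nbh_def)
  have "x \<notin> G.stars"
    using G.star_below(2)[OF low(1) _ y, of x] yx ne x by (auto simp: G.stars_def)
  moreover from this have "y \<notin> G.stars"
    using H.star_below(2)[OF low(2), of y x] xy x by (auto simp: stars_eq carrier_eq)
  ultimately show False
    using directions_not_opposite[OF x _ y _ ne yx xy] x y by (auto simp: G.stars_def)
qed

lemma direction_agrees:
  assumes low: G.stars_low H.stars_low and x: "x \<in> carrier G" "y \<in> carrier G"
    and ne: "nbh G y \<noteq> nbh G x"
  shows "y \<in> cyc H x \<longleftrightarrow> y \<in> cyc G x"
proof
  show "y \<in> cyc G x \<Longrightarrow> y \<in> cyc H x" by (rule direction_transfer[OF low x(1) _ ne])
  have "x \<in> carrier H" "nbh H y \<noteq> nbh H x" using x ne nbh_eq carrier_eq by simp_all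
  then show "y \<in> cyc H x \<Longrightarrow> y \<in> cyc G x"
    using two_groups.direction_transfer[OF swap low(2,1)] by blast
qed

text \<open>
  Both sets consist of the class itself and of the elements below it, and the latter do not depend
  on the group because directions agree.
\<close>

lemma maximal_cyclic_agrees:
  assumes low: G.stars_low H.stars_low and c: "c \<in> carrier G"
    and w: "w \<in> G.twins c" "G.twins c \<subseteq> cyc G w"
    and w': "w' \<in> H.twins c" "H.twins c \<subseteq> cyc H w'"
  shows "cyc G w = cyc H w'"
proof -
  have wc: "w \<in> carrier G" "nbh G w = nbh G c" using w by (auto simp: G.twins_def)
  have wc': "w' \<in> carrier G" "nbh G w' = nbh G c" using w' twins_eq[OF c] by (auto simp: G.twins_def)
  have "z \<in> cyc G w \<longleftrightarrow> z \<in> cyc H w'" if z: "z \<in> carrier G" for z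
  proof (cases "nbh G z = nbh G c")
    case True
    then have "z \<in> G.twins c" using z by (simp add: G.twins_def)
    then show ?thesis using w(2) w'(2) twins_eq[OF c] by auto
  next
    case False
    have "z \<in> cyc G w \<longleftrightarrow> z \<in> cyc H w"
      using direction_agrees[OF low wc(1) z] False wc(2) by simp
    also have "\<dots> \<longleftrightarrow> z \<in> cyc H w'"
      using H.cyc_twins_constant[OF low(2), of w z w' z] H.cyc_twins_constant[OF low(2), of w' z w z]
        z wc wc' False nbh_eq carrier_eq by auto
    finally show ?thesis .
  qed
  then show ?thesis using G.cyc_closed[OF wc(1)] H.cyc_closed[of w'] wc'(1) carrier_eq by auto
qed

text \<open>
  The class is an upper part of a cyclic group of known order n, in G as in H. The orders that
  occur are the divisors of n above a threshold. Two such sets of divisors are nested, and their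
  totients have the same sum, the size of the class; so the sets are equal.
\<close>

lemma orders_in_class_agree:
  assumes low: G.stars_low H.stars_low and c: "c \<in> carrier G"
  shows "card {z \<in> G.twins c. group.ord G z = k} = card {z \<in> G.twins c. group.ord H z = k}"
proof -
  have cH: "c \<in> carrier H" using c carrier_eq by simp
  obtain w where w: "w \<in> G.twins c" "G.twins c \<subseteq> cyc G w" using G.exists_max_twin[OF c] by blast
  obtain w' where w': "w' \<in> H.twins c" "H.twins c \<subseteq> cyc H w'" using H.exists_max_twin[OF cH] by blast
  have wc: "w \<in> carrier G" "G.twins w = G.twins c" using w by (auto simp: G.twins_def)
  have wc': "w' \<in> carrier H" "H.twins w' = H.twins c" using w' by (auto simp: H.twins_def)
  have cyc_eq: "cyc G w = cyc H w'" by (rule maximal_cyclic_agrees[OF low c w w'])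
  have n: "group.ord H w' = group.ord G w"
    using G.card_cyc[OF wc(1)] H.card_cyc[OF wc'(1)] cyc_eq by simp
  obtain m where m: "G.twins c = {z \<in> cyc G w. m \<le> group.ord G z}"
    using G.twins_upward_closed[OF low(1) wc(1)] w(2) wc(2) by metis
  obtain m' where m': "G.twins c = {z \<in> cyc H w'. m' \<le> group.ord H z}"
    using H.twins_upward_closed[OF low(2) wc'(1)] w'(2) wc'(2) twins_eq[OF c] by metis
  \<comment> \<open>The sets of orders that occur in the class, as computed in G and in H.\<close>
  let ?D = "\<lambda>m. {k. k dvd group.ord G w \<and> m \<le> k}"
  have fin_D: "finite (?D i)" for i using G.ord_pos[OF wc(1)] by simp
  have pos_D: "totient k > 0" if "k \<in> ?D i" for i k
    using that G.ord_pos[OF wc(1)] by (auto intro: gr0I)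
  have "sum totient (?D m) = card (G.twins c)"
    unfolding m by (rule G.card_upper_part(1)[OF wc(1), symmetric])
  moreover have "sum totient (?D m') = card (G.twins c)"
    unfolding m' n[symmetric] by (rule H.card_upper_part(1)[OF wc'(1), symmetric])
  ultimately have sums: "sum totient (?D m) = sum totient (?D m')" by simp
  have "?D m = ?D m'"
  proof (cases "m \<le> m'")
    case True
    then have "?D m' \<subseteq> ?D m" by auto
    from sum_eq_imp_nested_eq[where f = totient, OF fin_D this sums[symmetric] pos_D[of _ m]]
    show ?thesis by simp
  next
    case False
    then have "?D m \<subseteq> ?D m'" by auto
    from sum_eq_imp_nested_eq[where f = totient, OF fin_D this sums pos_D[of _ m']]
    show ?thesis by simp
  qed
  then have "k dvd group.ord G w \<and> m \<le> k \<longleftrightarrow> k dvd group.ord G w \<and> m' \<le> k" by blast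
  then have "(if k dvd group.ord G w \<and> m \<le> k then totient k else 0)
      = (if k dvd group.ord H w' \<and> m' \<le> k then totient k else 0)"
    unfolding n by simp
  moreover have "card {z \<in> G.twins c. group.ord G z = k} = (if k dvd group.ord G w \<and> m \<le> k then totient k else 0)"
    unfolding m by (rule G.card_upper_part(2)[OF wc(1)])
  moreover have "card {z \<in> G.twins c. group.ord H z = k} = (if k dvd group.ord H w' \<and> m' \<le> k then totient k else 0)"
    unfolding m' by (rule H.card_upper_part(2)[OF wc'(1)])
  ultimately show ?thesis by simp
qed

lemma bij_of_stars_low:
  assumes low: G.stars_low H.stars_low
  shows "\<exists>f. bij_betw f (carrier G) (carrier G) \<and>
    (\<forall>x \<in> carrier G. \<forall>y \<in> carrier G. y \<in> cyc G x \<longleftrightarrow> f y \<in> cyc H (f x))"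
proof -
  have "card {x \<in> carrier G. (nbh G x, group.ord G x) = K} = card {x \<in> carrier G. (nbh G x, group.ord H x) = K}" for K
  proof (cases "\<exists>c \<in> carrier G. nbh G c = fst K")
    case True
    then obtain c where c: "c \<in> carrier G" "nbh G c = fst K" by blast
    have "{x \<in> carrier G. (nbh G x, group.ord G x) = K} = {z \<in> G.twins c. group.ord G z = snd K}"
      "{x \<in> carrier G. (nbh G x, group.ord H x) = K} = {z \<in> G.twins c. group.ord H z = snd K}"
      using c by (auto simp: G.twins_def prod_eq_iff)
    then show ?thesis using orders_in_class_agree[OF low c(1)] by simp
  next
    case False
    then have "{x \<in> carrier G. (nbh G x, group.ord G x) = K} = {}"
      "{x \<in> carrier G. (nbh G x, group.ord H x) = K} = {}" by (auto simp: prod_eq_iff)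
    then show ?thesis by (simp only:)
  qed
  from bij_betw_of_equal_fibre_cards[OF G.fin this] obtain f where f: "bij_betw f (carrier G) (carrier G)"
    and fo: "\<And>x. x \<in> carrier G \<Longrightarrow> nbh G (f x) = nbh G x \<and> group.ord H (f x) = group.ord G x"
    by auto
  have fc: "f x \<in> carrier G" if "x \<in> carrier G" for x using bij_betwE[OF f] that by blast
  have "y \<in> cyc G x \<longleftrightarrow> f y \<in> cyc H (f x)" if xy: "x \<in> carrier G" "y \<in> carrier G" for x y
  proof (cases "nbh G y = nbh G x")
    case True
    then have "y \<in> G.twins x" "f y \<in> H.twins (f x)"
      using xy fc fo nbh_eq carrier_eq by (auto simp: G.twins_def H.twins_def)
    then show ?thesis
      using G.twins_cyc_iff_ord_dvd[OF xy(1)] H.twins_cyc_iff_ord_dvd[of "f x" "f y"]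
        fc[OF xy(1)] fo xy carrier_eq by simp
  next
    case False
    have "y \<in> cyc G x \<longleftrightarrow> y \<in> cyc H x" using direction_agrees[OF low xy False] by simp
    also have "\<dots> \<longleftrightarrow> f y \<in> cyc H (f x)"
      using H.cyc_twins_constant[OF low(2), of x y "f x" "f y"]
        H.cyc_twins_constant[OF low(2), of "f x" "f y" x y]
        False xy fc fo nbh_eq carrier_eq by auto
    finally show ?thesis .
  qed
  then show ?thesis using f by blast
qed

lemma bij_of_cyclic:
  assumes w: "w \<in> carrier G" "cyc G w = carrier G" and w': "w' \<in> carrier H" "cyc H w' = carrier H"
  shows "\<exists>f. bij_betw f (carrier G) (carrier G) \<and>
    (\<forall>x \<in> carrier G. \<forall>y \<in> carrier G. y \<in> cyc G x \<longleftrightarrow> f y \<in> cyc H (f x))"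
proof -
  have n: "group.ord H w' = group.ord G w"
    using G.card_cyc[OF w(1)] H.card_cyc[OF w'(1)] w w' carrier_eq by simp
  have "card {x \<in> carrier G. group.ord G x = k} = card {x \<in> carrier G. group.ord H x = k}" for k
    using G.card_upper_part(2)[OF w(1), of 0 k] H.card_upper_part(2)[OF w'(1), of 0 k] w w' n carrier_eq by simp
  from bij_betw_of_equal_fibre_cards[OF G.fin this] obtain f where f: "bij_betw f (carrier G) (carrier G)"
    and fo: "\<And>x. x \<in> carrier G \<Longrightarrow> group.ord H (f x) = group.ord G x"
    by auto
  have fc: "f x \<in> carrier G" if "x \<in> carrier G" for x using bij_betwE[OF f] that by blast
  have "y \<in> cyc G x \<longleftrightarrow> f y \<in> cyc H (f x)" if xy: "x \<in> carrier G" "y \<in> carrier G" for x y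
    using G.cyc_iff_ord_dvd[OF w(1), of x y] H.cyc_iff_ord_dvd[OF w'(1), of "f x" "f y"]
      w w' xy fc fo carrier_eq by simp
  then show ?thesis using f by blast
qed

text \<open>
  The stars include w and the identity of G, so if they formed a cyclic group of order p^k in H,
  a generator x of that group would be different from the identity of H. It would be adjacent to an
  element whose order is a prime other than p, which exists because the order of the group, being that of
  G, is not a prime power.
\<close>

lemma cyclic_not_stars_low:
  assumes w: "w \<in> carrier G" "cyc G w = carrier G" "\<not> prime_power_or_1 (group.ord G w)"
    and low: H.stars_low
  shows False
proof -
  obtain x where x: "x \<in> carrier H" "prime_power_or_1 (group.ord H x)" "H.stars = cyc H x"
    using low by (auto simp: H.stars_low_def)
  have "carrier G \<subseteq> nbh G w" using G.nbhI1[OF w(1)] w(2) by blast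
  then have "nbh G w = carrier G" unfolding nbh_def by blast
  then have "w \<in> H.stars" using w(1) by (simp add: stars_eq G.stars_def)
  have "w \<noteq> \<one>\<^bsub>G\<^esub>"
  proof
    assume "w = \<one>\<^bsub>G\<^esub>"
    then have "group.ord G w = 2 ^ 0" by simp
    then show False using w(3) two_is_prime_nat unfolding prime_power_or_1_def by blast
  qed
  moreover have "\<one>\<^bsub>G\<^esub> \<in> H.stars" by (simp add: stars_eq G.stars_def G.nbh_one)
  ultimately have x1: "group.ord H x \<noteq> 1"
    using \<open>w \<in> H.stars\<close> x(3) H.card_cyc[OF x(1)] by (metis card_1_singletonE singletonD)
  obtain p k where p: "prime p" "group.ord H x = p ^ k"
    using x(2) unfolding prime_power_or_1_def by blast
  have k: "k > 0" using p x1 by (auto intro: gr0I)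
  have n: "group.ord G w = card (carrier H)" using G.card_cyc[OF w(1)] w(2) carrier_eq by simp
  obtain q where q: "prime q" "q dvd group.ord G w" "q \<noteq> p"
    using other_prime_divisor[OF p(1) G.ord_pos[OF w(1)] w(3)] by blast
  obtain y where y: "y \<in> carrier H" "group.ord H y = q" using H.cauchy[OF q(1)] q(2) n by auto
  have "x \<in> H.stars" using x H.cyc_self by blast
  then have "y \<in> nbh H x" using y(1) by (simp add: H.stars_def)
  then have "q dvd p ^ k \<or> p ^ k dvd q" using H.nbh_ord[OF x(1), of y] y(2) p(2) by simp
  moreover have "\<not> q dvd p ^ k" using p(1) q by (metis prime_dvd_power primes_dvd_imp_eq)
  moreover have "\<not> p ^ k dvd q" using p(1) q k by (metis dvd_power dvd_trans primes_dvd_imp_eq)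
  ultimately show False by blast
qed

theorem directed_bijection:
  "\<exists>f. bij_betw f (carrier G) (carrier G) \<and>
    (\<forall>x \<in> carrier G. \<forall>y \<in> carrier G. y \<in> cyc G x \<longleftrightarrow> f y \<in> cyc H (f x))"
proof (cases G.stars_low)
  case True
  then have H.stars_low
    using H.stars_dichotomy two_groups.cyclic_not_stars_low[OF swap] by blast
  then show ?thesis using bij_of_stars_low True by blast
next
  case False
  then obtain w where w: "w \<in> carrier G" "cyc G w = carrier G" "\<not> prime_power_or_1 (group.ord G w)"
    using G.stars_dichotomy by blast
  then have "\<not> H.stars_low" using cyclic_not_stars_low by blast
  then obtain w' where "w' \<in> carrier H" "cyc H w' = carrier H"
    using H.stars_dichotomy by blast
  then show ?thesis using bij_of_cyclic w by blast
qed

end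

section \<open>Recursive functions and decidable relations\<close>

text \<open>
  Arguments are given by an environment of which a program sees the first n values. With
  environments instead of lists, a quantified variable becomes argument 0 and the others are
  shifted by one, and the rules below apply by unification with no side conditions on lengths.
\<close>

definition recursive :: "nat \<Rightarrow> ((nat \<Rightarrow> nat) \<Rightarrow> nat) \<Rightarrow> bool" where
  "recursive n f \<longleftrightarrow> (\<exists>r. \<forall>e. recf_eval r (map e [0..<n]) (f e))"

definition decidable :: "nat \<Rightarrow> ((nat \<Rightarrow> nat) \<Rightarrow> bool) \<Rightarrow> bool" where
  "decidable n P \<longleftrightarrow> recursive n (\<lambda>e. of_bool (P e))"

lemma recursive_var: "i < n \<Longrightarrow> recursive n (\<lambda>e. e i)"
  unfolding recursive_def
proof (intro exI allI)
  fix e :: "nat \<Rightarrow> nat" assume "i < n"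
  then show "recf_eval (Proj i) (map e [0..<n]) (e i)"
    using eval_Proj[of i "map e [0..<n]"] by simp
qed

lemma recursive_comp:
  assumes f: "recursive m f" and g: "\<And>i. i < m \<Longrightarrow> recursive n (g i)"
  shows "recursive n (\<lambda>e. f (\<lambda>i. g i e))"
proof -
  obtain r where r: "\<And>e. recf_eval r (map e [0..<m]) (f e)" using f recursive_def by auto
  obtain s where s: "\<And>i e. i < m \<Longrightarrow> recf_eval (s i) (map e [0..<n]) (g i e)"
    using g unfolding recursive_def by metis
  have "recf_eval (Comp r (map s [0..<m])) (map e [0..<n]) (f (\<lambda>i. g i e))" for e
    by (rule eval_Comp[OF _ r[of "\<lambda>i. g i e"]]) (simp add: list_all2_conv_all_nth s)
  then show ?thesis unfolding recursive_def by blast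
qed

lemma recursive_comp1:
  assumes "recursive 1 (\<lambda>e. F (e 0))" "recursive n f"
  shows "recursive n (\<lambda>e. F (f e))"
  using recursive_comp[OF assms(1), of n "\<lambda>i. f"] assms(2) by simp

lemma recursive_comp2:
  assumes "recursive 2 (\<lambda>e. F (e 0) (e 1))" "recursive n f" "recursive n g"
  shows "recursive n (\<lambda>e. F (f e) (g e))"
  using recursive_comp[OF assms(1), of n "\<lambda>i. if i = 0 then f else g"] assms(2,3) by simp

lemma recursive_primrec:
  assumes f: "recursive n f" and g: "recursive (Suc (Suc n)) g"
    and zero: "\<And>e. F 0 e = f e"
    and suc: "\<And>k e. F (Suc k) e = g (case_nat k (case_nat (F k e) e))"
  shows "recursive (Suc n) (\<lambda>e. F (e 0) (\<lambda>i. e (Suc i)))"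
proof -
  obtain rf where rf: "\<And>e. recf_eval rf (map e [0..<n]) (f e)" using f recursive_def by auto
  obtain rg where rg: "\<And>e. recf_eval rg (map e [0..<Suc (Suc n)]) (g e)" using g recursive_def by auto
  have cons: "map e [0..<Suc k] = e 0 # map (\<lambda>i. e (Suc i)) [0..<k]" for e :: "nat \<Rightarrow> nat" and k
    by (simp only: map_upt_Suc)
  have "recf_eval (PrimRec rf rg) (k # map e [0..<n]) (F k e)" for k e
  proof (induction k)
    case 0
    show ?case using rf zero by (simp add: eval_PrimRec_0)
  next
    case (Suc k)
    show ?case unfolding suc
      by (rule eval_PrimRec_Suc[OF Suc]) (use rg[of "case_nat k (case_nat (F k e) e)"] in \<open>simp only: cons nat.case\<close>)
  qed
  then have "recf_eval (PrimRec rf rg) (map e [0..<Suc n]) (F (e 0) (\<lambda>i. e (Suc i)))" for e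
    unfolding cons by blast
  then show ?thesis unfolding recursive_def by blast
qed

lemma recursive_Suc:
  assumes "recursive n f" shows "recursive n (\<lambda>e. Suc (f e))"
proof -
  have "recf_eval Succ (map e [0..<1]) (Suc (e 0))" for e using eval_Succ by simp
  then have "recursive 1 (\<lambda>e. Suc (e 0))" unfolding recursive_def by blast
  from recursive_comp1[where F = Suc, OF this assms] show ?thesis .
qed

lemma recursive_const: "recursive n (\<lambda>e. c)"
proof (induction c)
  case 0
  show ?case unfolding recursive_def using eval_Zero by blast
qed (rule recursive_Suc)

lemma recursive_add:
  assumes "recursive n f" "recursive n g" shows "recursive n (\<lambda>e. f e + g e)"
proof -
  have "recursive 2 (\<lambda>e. e 0 + e 1)"
    using recursive_primrec[of 1 "\<lambda>e. e 0" "\<lambda>e. Suc (e 1)" "\<lambda>k e. k + e 0"]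
    by (simp add: recursive_var recursive_Suc numeral_2_eq_2)
  from recursive_comp2[where F = "(+)", OF this assms] show ?thesis .
qed

lemma recursive_mult:
  assumes "recursive n f" "recursive n g" shows "recursive n (\<lambda>e. f e * g e)"
proof -
  have "recursive 2 (\<lambda>e. e 0 * e 1)"
    using recursive_primrec[of 1 "\<lambda>e. 0" "\<lambda>e. e 2 + e 1" "\<lambda>k e. k * e 0"]
    by (simp add: recursive_var recursive_const recursive_add numeral_2_eq_2)
  from recursive_comp2[where F = "(*)", OF this assms] show ?thesis .
qed

lemma recursive_diff:
  assumes "recursive n f" "recursive n g" shows "recursive n (\<lambda>e. f e - g e)"
proof -
  have "recursive 1 (\<lambda>e. e 0 - 1)"
    using recursive_primrec[of 0 "\<lambda>e. 0" "\<lambda>e. e 0" "\<lambda>k e. k - 1"]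
    by (simp add: recursive_var recursive_const)
  from recursive_comp1[where F = "\<lambda>k. k - 1", OF this]
  have pred: "recursive m h \<Longrightarrow> recursive m (\<lambda>e. h e - 1)" for m h .
  have "recursive (Suc 1) (\<lambda>e. e (Suc 0) - e 0)"
    by (rule recursive_primrec[of 1 "\<lambda>e. e 0" "\<lambda>e. e 1 - 1" "\<lambda>k e. e 0 - k"])
      (auto intro!: recursive_var pred[simplified])
  then have "recursive 2 (\<lambda>e. e 1 - e 0)" by (simp add: numeral_2_eq_2)
  from recursive_comp2[where F = "\<lambda>j k. k - j", OF this assms(2,1)] show ?thesis .
qed

lemma recursive_power2:
  assumes "recursive n f" shows "recursive n (\<lambda>e. 2 ^ f e)"
proof -
  have "recursive 1 (\<lambda>e. 2 ^ e 0)"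
    using recursive_primrec[of 0 "\<lambda>e. 1" "\<lambda>e. e 1 + e 1" "\<lambda>k e. 2 ^ k"]
    by (simp add: recursive_var recursive_const recursive_add mult_2)
  from recursive_comp1[where F = "\<lambda>k. 2 ^ k", OF this assms] show ?thesis .
qed

lemma recursive_prod_encode:
  assumes "recursive n f" "recursive n g"
  shows "recursive n (\<lambda>e. prod_encode (f e, g e))"
proof -
  have "recursive 1 (\<lambda>e. triangle (e 0))"
    using recursive_primrec[of 0 "\<lambda>e. 0" "\<lambda>e. e 1 + Suc (e 0)" "\<lambda>k e. triangle k"]
    by (simp add: recursive_var recursive_const recursive_add recursive_Suc)
  from recursive_add[OF recursive_comp1[where F = triangle, OF this recursive_add[OF assms]] assms(1)]
  show ?thesis by (simp add: prod_encode_def)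
qed

lemma decidable_less:
  assumes "recursive n f" "recursive n g" shows "decidable n (\<lambda>e. f e < g e)"
proof -
  have eq: "(\<lambda>e. 1 - (1 - (g e - f e))) = (\<lambda>e. of_bool (f e < g e))" by (auto simp: fun_eq_iff)
  have "recursive n (\<lambda>e. 1 - (1 - (g e - f e)))" by (intro recursive_diff recursive_const assms)
  then show ?thesis unfolding eq decidable_def .
qed

lemma decidable_not:
  assumes "decidable n P" shows "decidable n (\<lambda>e. \<not> P e)"
proof -
  have eq: "(\<lambda>e. 1 - of_bool (P e) :: nat) = (\<lambda>e. of_bool (\<not> P e))" by (simp add: fun_eq_iff)
  have "recursive n (\<lambda>e. 1 - of_bool (P e))"
    by (intro recursive_diff recursive_const assms[unfolded decidable_def])
  then show ?thesis unfolding eq decidable_def .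
qed

lemma decidable_conj:
  assumes "decidable n P" "decidable n Q" shows "decidable n (\<lambda>e. P e \<and> Q e)"
  unfolding decidable_def of_bool_conj by (rule recursive_mult[OF assms[unfolded decidable_def]])

lemma decidable_disj:
  assumes "decidable n P" "decidable n Q" shows "decidable n (\<lambda>e. P e \<or> Q e)"
  using decidable_not[OF decidable_conj[OF assms[THEN decidable_not]]] by (simp only: de_Morgan_conj not_not)

lemma decidable_imp:
  assumes "decidable n P" "decidable n Q" shows "decidable n (\<lambda>e. P e \<longrightarrow> Q e)"
  using decidable_disj[OF decidable_not[OF assms(1)] assms(2)] by (simp only: imp_conv_disj)

lemma decidable_iff:
  assumes "decidable n P" "decidable n Q" shows "decidable n (\<lambda>e. P e \<longleftrightarrow> Q e)"
  using decidable_conj[OF decidable_imp[OF assms] decidable_imp[OF assms(2,1)]]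
  by (simp only: iff_conv_conj_imp)

lemma decidable_eq:
  assumes "recursive n f" "recursive n g" shows "decidable n (\<lambda>e. f e = g e)"
  using decidable_not[OF decidable_disj[OF decidable_less[OF assms] decidable_less[OF assms(2,1)]]]
  by (simp only: linorder_neq_iff[symmetric] not_not)

lemma decidable_ex_less:
  assumes b: "recursive n b" and P: "decidable (Suc n) (\<lambda>e. P (e 0) (\<lambda>i. e (Suc i)))"
  shows "decidable n (\<lambda>e. \<exists>i < b e. P i e)"
proof -
  have "recursive (Suc (Suc n)) (\<lambda>e. of_bool (P (e (if 0 = (0::nat) then 0 else Suc 0)) (\<lambda>i. e (if Suc i = 0 then 0 else Suc (Suc i)))))"
    using recursive_comp[OF P[unfolded decidable_def], of "Suc (Suc n)" "\<lambda>i e. e (if i = 0 then 0 else Suc i)"]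
    by (simp add: recursive_var)
  then have "decidable (Suc (Suc n)) (\<lambda>e. P (e 0) (\<lambda>i. e (Suc (Suc i))))"
    by (simp add: decidable_def)
  \<comment> \<open>Argument 0 is the recursion counter, argument 1 the truth value accumulated so far.\<close>
  then have "decidable (Suc (Suc n)) (\<lambda>e. e 1 = 1 \<or> P (e 0) (\<lambda>i. e (Suc (Suc i))))"
    by (intro decidable_disj decidable_eq recursive_var recursive_const) auto
  then have step: "recursive (Suc (Suc n)) (\<lambda>e. of_bool (e 1 = 1 \<or> P (e 0) (\<lambda>i. e (Suc (Suc i)))))"
    by (simp add: decidable_def)
  have "recursive (Suc n) (\<lambda>e. of_bool (\<exists>j < e 0. P j (\<lambda>i. e (Suc i))))"
    by (rule recursive_primrec[OF recursive_const[of n 0] step, where F = "\<lambda>k e. of_bool (\<exists>j < k. P j e)"])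
      (auto simp: less_Suc_eq)
  from recursive_comp[OF this, of n "case_nat b (\<lambda>i e. e i)"]
  show ?thesis using b by (simp add: decidable_def recursive_var split: nat.splits)
qed

lemma decidable_ex_le:
  assumes "recursive n b" "decidable (Suc n) (\<lambda>e. P (e 0) (\<lambda>i. e (Suc i)))"
  shows "decidable n (\<lambda>e. \<exists>i \<le> b e. P i e)"
  using decidable_ex_less[OF recursive_Suc[OF assms(1)] assms(2)] by (simp add: less_Suc_eq_le)

lemma decidable_all_le:
  assumes "recursive n b" "decidable (Suc n) (\<lambda>e. P (e 0) (\<lambda>i. e (Suc i)))"
  shows "decidable n (\<lambda>e. \<forall>i \<le> b e. P i e)"
  using decidable_not[OF decidable_ex_le[OF assms(1) decidable_not[OF assms(2)]]] by simp

text \<open>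
  Membership in a coded set written with bounded quantifiers only: bit k of s is 1.
\<close>

lemma set_decode_iff:
  "k \<in> set_decode s \<longleftrightarrow> (\<exists>q \<le> s. \<exists>r < 2 ^ k. s = (2 * q + 1) * 2 ^ k + r)"
proof
  assume "k \<in> set_decode s"
  then have "odd (s div 2 ^ k)" by (simp add: set_decode_def)
  then obtain q where q: "s div 2 ^ k = 2 * q + 1" by (rule oddE)
  have "s = (2 * q + 1) * 2 ^ k + s mod 2 ^ k" using q by (metis div_mult_mod_eq)
  moreover have "q \<le> s" using q by (metis div_le_dividend le_add1 le_trans mult_2 trans_le_add1)
  ultimately show "\<exists>q \<le> s. \<exists>r < 2 ^ k. s = (2 * q + 1) * 2 ^ k + r"
    by (metis mod_less_divisor pos2 zero_less_power)
next
  assume "\<exists>q \<le> s. \<exists>r < 2 ^ k. s = (2 * q + 1) * 2 ^ k + r"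
  then obtain q r where r: "r < 2 ^ k" and s: "s = (2 * q + 1) * 2 ^ k + r" by blast
  have "s div 2 ^ k = 2 * q + 1" unfolding s by (subst div_mult_self3) (use r in simp_all)
  then show "k \<in> set_decode s" by (simp add: set_decode_def)
qed

lemma set_decode_le: "k \<in> set_decode s \<Longrightarrow> k \<le> s"
proof -
  assume "k \<in> set_decode s"
  then have "s div 2 ^ k \<noteq> 0" by (auto simp: set_decode_def intro: ccontr)
  then have "2 ^ k \<le> s" by (simp add: div_eq_0_iff)
  then show "k \<le> s" using less_exp[of k] by linarith
qed

lemma decidable_mem:
  assumes "recursive n f" "recursive n g"
  shows "decidable n (\<lambda>e. f e \<in> set_decode (g e))"
proof -
  have "decidable 2 (\<lambda>e. e 0 \<in> set_decode (e 1))"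
    unfolding set_decode_iff
    by (intro decidable_ex_le decidable_ex_less decidable_eq recursive_add recursive_mult recursive_power2
        recursive_var recursive_const) auto
  from recursive_comp2[where F = "\<lambda>j k. of_bool (j \<in> set_decode k)", OF this[unfolded decidable_def] assms]
  show ?thesis by (simp add: decidable_def)
qed

lemma decidable_bex:
  assumes "recursive n g" "decidable (Suc n) (\<lambda>e. P (e 0) (\<lambda>i. e (Suc i)))"
  shows "decidable n (\<lambda>e. \<exists>x \<in> set_decode (g e). P x e)"
proof -
  have "recursive (Suc n) (\<lambda>e. g (\<lambda>i. e (Suc i)))"
    using assms(1) by (rule recursive_comp) (simp add: recursive_var)
  then have "decidable n (\<lambda>e. \<exists>x \<le> g e. x \<in> set_decode (g e) \<and> P x e)"
    by (intro decidable_ex_le decidable_conj decidable_mem recursive_var assms) simp_all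
  moreover have "(\<exists>x \<in> set_decode (g e). P x e) \<longleftrightarrow> (\<exists>x \<le> g e. x \<in> set_decode (g e) \<and> P x e)" for e
    using set_decode_le by blast
  ultimately show ?thesis by simp
qed

lemma decidable_ball:
  assumes "recursive n g" "decidable (Suc n) (\<lambda>e. P (e 0) (\<lambda>i. e (Suc i)))"
  shows "decidable n (\<lambda>e. \<forall>x \<in> set_decode (g e). P x e)"
  using decidable_not[OF decidable_bex[OF assms(1) decidable_not[OF assms(2)]]] by simp

lemmas decidable_intros = decidable_conj decidable_disj decidable_imp decidable_iff decidable_not
  decidable_eq decidable_mem decidable_bex decidable_ball decidable_ex_le decidable_all_le
  recursive_prod_encode recursive_const recursive_var

lemma eval_Mu_Least:
  assumes r: "\<And>n. recf_eval r (n # xs) (of_bool (\<not> P n))" and ex: "\<exists>n. P n"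
  shows "recf_eval (Mu r) xs (LEAST n. P n)"
proof (rule eval_Mu)
  show "recf_eval r ((LEAST n. P n) # xs) 0" using r[of "LEAST n. P n"] LeastI_ex[OF ex] by simp
  fix m assume "m < (LEAST n. P n)"
  then have "\<not> P m" by (rule not_less_Least)
  then show "\<exists>y > 0. recf_eval r (m # xs) y" using r[of m] by (intro exI[of _ 1]) simp
qed

section \<open>Searching for a group with a given power graph\<close>

definition table_entry :: "nat \<Rightarrow> nat \<Rightarrow> nat \<Rightarrow> nat \<Rightarrow> bool" where
  "table_entry T x y z \<longleftrightarrow> prod_encode (x, prod_encode (y, z)) \<in> set_decode T"

text \<open>
  The numbers v and T code the underlying set and the graph of the multiplication. A left unit and
  left inverses suffice for a group.
\<close>

definition group_table :: "nat \<Rightarrow> nat \<Rightarrow> bool" where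
  "group_table v T \<longleftrightarrow>
     (\<forall>x \<in> set_decode v. \<forall>y \<in> set_decode v. \<exists>z \<in> set_decode v. \<forall>w \<in> set_decode v. table_entry T x y w \<longleftrightarrow> w = z) \<and>
     (\<forall>x \<in> set_decode v. \<forall>y \<in> set_decode v. \<forall>z \<in> set_decode v.
       \<forall>a \<in> set_decode v. \<forall>b \<in> set_decode v. \<forall>c \<in> set_decode v.
         table_entry T x y a \<and> table_entry T y z b \<longrightarrow> (table_entry T a z c \<longleftrightarrow> table_entry T x b c)) \<and>
     (\<exists>u \<in> set_decode v. (\<forall>x \<in> set_decode v. table_entry T u x x) \<and>
       (\<forall>x \<in> set_decode v. \<exists>y \<in> set_decode v. table_entry T y x u))"

text \<open>
  The positive powers of x are the smallest set that contains x and is closed under multiplication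
  by x. Codes of subsets of a set are at most the code of the set, so quantifying over all these
  sets is a bounded quantifier, and no exponents are needed.
\<close>

definition power_in :: "nat \<Rightarrow> nat \<Rightarrow> nat \<Rightarrow> nat \<Rightarrow> bool" where
  "power_in v T x y \<longleftrightarrow> (\<forall>s \<le> v. x \<in> set_decode s \<and>
     (\<forall>a \<in> set_decode v. \<forall>b \<in> set_decode v. a \<in> set_decode s \<and> table_entry T a x b \<longrightarrow> b \<in> set_decode s)
     \<longrightarrow> y \<in> set_decode s)"

text \<open>
  The first clause says that the set coded by a contains nothing but arcs.
\<close>

definition arcs_coded :: "nat \<Rightarrow> nat \<Rightarrow> (nat \<Rightarrow> nat \<Rightarrow> bool) \<Rightarrow> bool" where
  "arcs_coded v a R \<longleftrightarrow>
     (\<forall>k \<in> set_decode a. \<exists>x \<in> set_decode v. \<exists>y \<in> set_decode v. k = prod_encode (x, y)) \<and>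
     (\<forall>x \<in> set_decode v. \<forall>y \<in> set_decode v. prod_encode (x, y) \<in> set_decode a \<longleftrightarrow> R x y)"

definition witness :: "nat \<Rightarrow> nat \<Rightarrow> nat \<Rightarrow> bool" where
  "witness c T d \<longleftrightarrow> (\<exists>v \<le> c. \<exists>a \<le> c. \<exists>b \<le> d.
     c = prod_encode (v, a) \<and> d = prod_encode (v, b) \<and> group_table v T \<and>
     arcs_coded v a (\<lambda>x y. x \<noteq> y \<and> (power_in v T x y \<or> power_in v T y x)) \<and>
     arcs_coded v b (\<lambda>x y. x \<noteq> y \<and> power_in v T x y))"

lemma decidable_witness:
  assumes "i < n" "j < n" "k < n"
  shows "decidable n (\<lambda>e. witness (e i) (e j) (e k))"
  unfolding witness_def group_table_def arcs_coded_def power_in_def table_entry_def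
  by (intro decidable_intros; (simp add: assms)?)

lemma arcs_coded_iff:
  "arcs_coded v a R \<longleftrightarrow>
     set_decode a = prod_encode ` {(x, y). x \<in> set_decode v \<and> y \<in> set_decode v \<and> R x y}"
proof
  assume *: "arcs_coded v a R"
  show "set_decode a = prod_encode ` {(x, y). x \<in> set_decode v \<and> y \<in> set_decode v \<and> R x y}"
  proof (intro equalityI subsetI)
    fix k assume k: "k \<in> set_decode a"
    then obtain x y where "x \<in> set_decode v" "y \<in> set_decode v" "k = prod_encode (x, y)"
      using * unfolding arcs_coded_def by blast
    moreover from this have "R x y" using * k unfolding arcs_coded_def by blast
    ultimately show "k \<in> prod_encode ` {(x, y). x \<in> set_decode v \<and> y \<in> set_decode v \<and> R x y}" by blast
  qed (use * in \<open>auto simp: arcs_coded_def\<close>)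
next
  assume *: "set_decode a = prod_encode ` {(x, y). x \<in> set_decode v \<and> y \<in> set_decode v \<and> R x y}"
  show "arcs_coded v a R" unfolding arcs_coded_def * by auto
qed

lemma power_in_iff:
  fixes G :: "nat monoid"
  assumes G: "finite_group G" and v: "set_decode v = carrier G"
    and T: "\<And>x y z. x \<in> carrier G \<Longrightarrow> y \<in> carrier G \<Longrightarrow> z \<in> carrier G \<Longrightarrow> table_entry T x y z \<longleftrightarrow> z = x \<otimes>\<^bsub>G\<^esub> y"
    and x: "x \<in> carrier G"
  shows "power_in v T x y \<longleftrightarrow> (\<exists>m::nat. m > 0 \<and> y = x [^]\<^bsub>G\<^esub> m)"
proof
  interpret group G using G by (simp add: finite_group_def)
  assume p: "power_in v T x y"
  let ?S = "{x [^]\<^bsub>G\<^esub> m | m::nat. m > 0}"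
  have sub: "?S \<subseteq> carrier G" using x by auto
  then have fin: "finite ?S" using G by (auto simp: finite_group_def intro: finite_subset)
  have dec: "set_decode (set_encode ?S) = ?S" using fin by (rule set_encode_inverse)
  then have le: "set_encode ?S \<le> v" using sub v by (intro subset_decode_imp_le) simp
  have "x \<in> ?S" using x by (auto intro!: exI[of _ "1::nat"])
  moreover have "b \<in> ?S" if ab: "a \<in> carrier G" "b \<in> carrier G" "a \<in> ?S" "table_entry T a x b" for a b
  proof -
    obtain m where "a = x [^]\<^bsub>G\<^esub> (m::nat)" using ab(3) by blast
    then have "b = x [^]\<^bsub>G\<^esub> (Suc m)" using T[OF ab(1) x ab(2)] ab(4) by simp
    then show ?thesis by blast
  qed
  ultimately have "y \<in> ?S" using p[unfolded power_in_def, rule_format, OF le] unfolding dec v by blast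
  then show "\<exists>m::nat. m > 0 \<and> y = x [^]\<^bsub>G\<^esub> m" by blast
next
  interpret group G using G by (simp add: finite_group_def)
  assume "\<exists>m::nat. m > 0 \<and> y = x [^]\<^bsub>G\<^esub> m"
  then obtain m where m: "y = x [^]\<^bsub>G\<^esub> Suc m" by (metis gr0_conv_Suc)
  show "power_in v T x y" unfolding power_in_def
  proof (intro allI impI, elim conjE)
    fix s assume s: "x \<in> set_decode s"
      and cl: "\<forall>a \<in> set_decode v. \<forall>b \<in> set_decode v. a \<in> set_decode s \<and> table_entry T a x b \<longrightarrow> b \<in> set_decode s"
    have "x [^]\<^bsub>G\<^esub> Suc k \<in> set_decode s" for k
    proof (induction k)
      case (Suc k)
      have "table_entry T (x [^]\<^bsub>G\<^esub> Suc k) x (x [^]\<^bsub>G\<^esub> Suc (Suc k))"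
        using T[of "x [^]\<^bsub>G\<^esub> Suc k" x "x [^]\<^bsub>G\<^esub> Suc (Suc k)"] x by simp
      moreover have "x [^]\<^bsub>G\<^esub> Suc k \<in> set_decode v" "x [^]\<^bsub>G\<^esub> Suc (Suc k) \<in> set_decode v"
        unfolding v by (rule nat_pow_closed[OF x])+
      ultimately show ?case using cl Suc by blast
    qed (use s x in simp)
    then show "y \<in> set_decode s" using m by simp
  qed
qed

lemma arcs_coded_power_graphs:
  fixes G :: "nat monoid"
  assumes G: "finite_group G" and v: "set_decode v = carrier G"
    and T: "\<And>x y z. x \<in> carrier G \<Longrightarrow> y \<in> carrier G \<Longrightarrow> z \<in> carrier G \<Longrightarrow> table_entry T x y z \<longleftrightarrow> z = x \<otimes>\<^bsub>G\<^esub> y"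
  shows "arcs_coded v a (\<lambda>x y. x \<noteq> y \<and> (power_in v T x y \<or> power_in v T y x)) \<longleftrightarrow>
      prod_encode (v, a) = digraph_code (power_graph G)"
    and "arcs_coded v b (\<lambda>x y. x \<noteq> y \<and> power_in v T x y) \<longleftrightarrow>
      prod_encode (v, b) = digraph_code (directed_power_graph G)"
proof -
  have fin: "finite (carrier G)" using G by (simp add: finite_group_def)
  have code: "set_decode n = A \<longleftrightarrow> n = set_encode A" if "finite A" for n A
    using that by (metis set_decode_inverse set_encode_inverse)
  have fin_arcs: "finite (prod_encode ` {(x, y). x \<in> carrier G \<and> y \<in> carrier G \<and> R x y})" for R
    by (rule finite_imageI, rule finite_subset[of _ "carrier G \<times> carrier G"]) (use fin in auto)
  have vc: "v = set_encode (carrier G)" using code[OF fin] v by simp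
  have "{(x, y). x \<in> set_decode v \<and> y \<in> set_decode v \<and> x \<noteq> y \<and> (power_in v T x y \<or> power_in v T y x)}
      = parcs (power_graph G)"
    using power_in_iff[OF G v T] unfolding v power_graph_def by auto
  then show "arcs_coded v a (\<lambda>x y. x \<noteq> y \<and> (power_in v T x y \<or> power_in v T y x)) \<longleftrightarrow>
      prod_encode (v, a) = digraph_code (power_graph G)"
    using code[OF fin_arcs] vc
    by (simp add: arcs_coded_iff digraph_code_def) (simp add: power_graph_def v)
  have "{(x, y). x \<in> set_decode v \<and> y \<in> set_decode v \<and> x \<noteq> y \<and> power_in v T x y}
      = parcs (directed_power_graph G)"
    using power_in_iff[OF G v T] unfolding v directed_power_graph_def by auto
  then show "arcs_coded v b (\<lambda>x y. x \<noteq> y \<and> power_in v T x y) \<longleftrightarrow>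
      prod_encode (v, b) = digraph_code (directed_power_graph G)"
    using code[OF fin_arcs] vc
    by (simp add: arcs_coded_iff digraph_code_def) (simp add: directed_power_graph_def v)
qed

lemma group_of_table:
  assumes "group_table v T"
  shows "\<exists>G :: nat monoid. finite_group G \<and> carrier G = set_decode v \<and>
    (\<forall>x \<in> carrier G. \<forall>y \<in> carrier G. \<forall>z \<in> carrier G. table_entry T x y z \<longleftrightarrow> z = x \<otimes>\<^bsub>G\<^esub> y)"
proof -
  let ?V = "set_decode v"
  from assms obtain f where f: "\<And>x y. x \<in> ?V \<Longrightarrow> y \<in> ?V \<Longrightarrow> f x y \<in> ?V"
    and Tf: "\<And>x y w. x \<in> ?V \<Longrightarrow> y \<in> ?V \<Longrightarrow> w \<in> ?V \<Longrightarrow> table_entry T x y w \<longleftrightarrow> w = f x y"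
    unfolding group_table_def by metis
  from assms obtain u where u: "u \<in> ?V" "\<And>x. x \<in> ?V \<Longrightarrow> table_entry T u x x"
    "\<And>x. x \<in> ?V \<Longrightarrow> \<exists>y \<in> ?V. table_entry T y x u"
    unfolding group_table_def by blast
  have assoc: "\<And>x y z a b c. x \<in> ?V \<Longrightarrow> y \<in> ?V \<Longrightarrow> z \<in> ?V \<Longrightarrow> a \<in> ?V \<Longrightarrow> b \<in> ?V \<Longrightarrow> c \<in> ?V \<Longrightarrow>
      table_entry T x y a \<Longrightarrow> table_entry T y z b \<Longrightarrow> table_entry T a z c \<longleftrightarrow> table_entry T x b c"
    using assms unfolding group_table_def by blast
  define G where "G = \<lparr>carrier = ?V, monoid.mult = f, one = u\<rparr>"
  have "group G"
  proof (rule groupI)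
    fix x y z assume xyz: "x \<in> carrier G" "y \<in> carrier G" "z \<in> carrier G"
    then have "f (f x y) z = f x (f y z)"
      using assoc[of x y z "f x y" "f y z" "f (f x y) z"] f Tf by (simp add: G_def)
    then show "x \<otimes>\<^bsub>G\<^esub> y \<otimes>\<^bsub>G\<^esub> z = x \<otimes>\<^bsub>G\<^esub> (y \<otimes>\<^bsub>G\<^esub> z)" by (simp add: G_def)
  next
    fix x assume x: "x \<in> carrier G"
    then show "\<one>\<^bsub>G\<^esub> \<otimes>\<^bsub>G\<^esub> x = x" using u Tf by (fastforce simp: G_def)
    show "\<exists>y \<in> carrier G. y \<otimes>\<^bsub>G\<^esub> x = \<one>\<^bsub>G\<^esub>" using x u(1,3) Tf by (fastforce simp: G_def)
  qed (use f u in \<open>auto simp: G_def\<close>)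
  then have "finite_group G" by (simp add: finite_group_def G_def)
  then show ?thesis using Tf by (intro exI[of _ G]) (simp add: G_def)
qed

lemma table_of_group:
  fixes G :: "nat monoid"
  assumes G: "finite_group G"
  shows "\<exists>T. group_table (set_encode (carrier G)) T \<and>
    (\<forall>x \<in> carrier G. \<forall>y \<in> carrier G. \<forall>z \<in> carrier G. table_entry T x y z \<longleftrightarrow> z = x \<otimes>\<^bsub>G\<^esub> y)"
proof -
  interpret group G using G by (simp add: finite_group_def)
  have fin: "finite (carrier G)" using G by (simp add: finite_group_def)
  let ?M = "(\<lambda>(x, y). prod_encode (x, prod_encode (y, x \<otimes>\<^bsub>G\<^esub> y))) ` (carrier G \<times> carrier G)"
  define T where "T = set_encode ?M"
  have "set_decode T = ?M" unfolding T_def using fin by (intro set_encode_inverse) simp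
  then have T: "table_entry T x y z \<longleftrightarrow> z = x \<otimes>\<^bsub>G\<^esub> y" if "x \<in> carrier G" "y \<in> carrier G" for x y z
    unfolding table_entry_def using that by auto
  have v: "set_decode (set_encode (carrier G)) = carrier G" using fin by (rule set_encode_inverse)
  have "group_table (set_encode (carrier G)) T"
    unfolding group_table_def v
  proof (intro conjI ballI impI)
    fix x y assume "x \<in> carrier G" "y \<in> carrier G"
    then show "\<exists>z \<in> carrier G. \<forall>w \<in> carrier G. table_entry T x y w \<longleftrightarrow> w = z" using T by blast
  next
    fix x y z a b c
    assume c: "x \<in> carrier G" "y \<in> carrier G" "z \<in> carrier G" "a \<in> carrier G" "b \<in> carrier G" "c \<in> carrier G"
      and "table_entry T x y a \<and> table_entry T y z b"
    then have "a = x \<otimes>\<^bsub>G\<^esub> y" "b = y \<otimes>\<^bsub>G\<^esub> z" using T by auto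
    then show "table_entry T a z c \<longleftrightarrow> table_entry T x b c" using T c by (simp add: m_assoc)
  next
    have "table_entry T (inv\<^bsub>G\<^esub> x) x \<one>\<^bsub>G\<^esub>" "table_entry T \<one>\<^bsub>G\<^esub> x x" if "x \<in> carrier G" for x
      using T that by simp_all
    then show "\<exists>u \<in> carrier G. (\<forall>x \<in> carrier G. table_entry T u x x) \<and> (\<forall>x \<in> carrier G. \<exists>y \<in> carrier G. table_entry T y x u)"
      by (intro bexI[of _ "\<one>\<^bsub>G\<^esub>"]) (auto intro: inv_closed)
  qed
  then show ?thesis using T by blast
qed

lemma witness_sound:
  assumes "witness c T d"
  shows "\<exists>G :: nat monoid. finite_group G \<and> c = digraph_code (power_graph G) \<and>
    d = digraph_code (directed_power_graph G)"
proof -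
  obtain v a b where w: "c = prod_encode (v, a)" "d = prod_encode (v, b)" "group_table v T"
    "arcs_coded v a (\<lambda>x y. x \<noteq> y \<and> (power_in v T x y \<or> power_in v T y x))"
    "arcs_coded v b (\<lambda>x y. x \<noteq> y \<and> power_in v T x y)"
    using assms unfolding witness_def by blast
  obtain G :: "nat monoid" where G: "finite_group G" "set_decode v = carrier G"
    and T: "\<And>x y z. x \<in> carrier G \<Longrightarrow> y \<in> carrier G \<Longrightarrow> z \<in> carrier G \<Longrightarrow> table_entry T x y z \<longleftrightarrow> z = x \<otimes>\<^bsub>G\<^esub> y"
    using group_of_table[OF w(3)] by metis
  have "c = digraph_code (power_graph G)"
    using arcs_coded_power_graphs(1)[OF G T, of a] w(1,4) by simp
  moreover have "d = digraph_code (directed_power_graph G)"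
    using arcs_coded_power_graphs(2)[OF G T, of b] w(2,5) by simp
  ultimately show ?thesis using G(1) by blast
qed

lemma witness_complete:
  fixes G :: "nat monoid"
  assumes G: "finite_group G"
  shows "\<exists>T. witness (digraph_code (power_graph G)) T (digraph_code (directed_power_graph G))"
proof -
  let ?v = "set_encode (carrier G)"
  obtain T where gt: "group_table ?v T"
    and T: "\<And>x y z. x \<in> carrier G \<Longrightarrow> y \<in> carrier G \<Longrightarrow> z \<in> carrier G \<Longrightarrow> table_entry T x y z \<longleftrightarrow> z = x \<otimes>\<^bsub>G\<^esub> y"
    using table_of_group[OF G] by blast
  have v: "set_decode ?v = carrier G" using G by (simp add: finite_group_def)
  obtain a b where a: "digraph_code (power_graph G) = prod_encode (?v, a)"
    and b: "digraph_code (directed_power_graph G) = prod_encode (?v, b)"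
    by (auto simp: digraph_code_def power_graph_def directed_power_graph_def)
  have "witness (prod_encode (?v, a)) T (prod_encode (?v, b))"
    unfolding witness_def
  proof (intro exI conjI)
    show "arcs_coded ?v a (\<lambda>x y. x \<noteq> y \<and> (power_in ?v T x y \<or> power_in ?v T y x))"
      using arcs_coded_power_graphs(1)[OF G v T, of a] a by simp
    show "arcs_coded ?v b (\<lambda>x y. x \<noteq> y \<and> power_in ?v T x y)"
      using arcs_coded_power_graphs(2)[OF G v T, of b] b by simp
  qed (rule gt refl le_prod_encode_1 le_prod_encode_2)+
  then show ?thesis unfolding a b by blast
qed

text \<open>
  The program minimises twice. The first search finds a bound w below which some table and some
  digraph form a witness. The second returns the least digraph code that has a witness table up to
  w, which is again the code of the directed power graph of a group with the given power graph.
  The code of an output digraph is 2 * d + 1.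
\<close>

lemma reconstruction_program:
  "\<exists>r. \<forall>\<Gamma>. is_power_graph \<Gamma> \<longrightarrow> (\<exists>G :: nat monoid. finite_group G \<and> \<Gamma> = power_graph G \<and>
     recf_eval r [digraph_code \<Gamma>] (output_code (Digraph (directed_power_graph G))))"
proof -
  let ?P = "\<lambda>c w. \<exists>T \<le> w. \<exists>d \<le> w. witness c T d"
  let ?Q = "\<lambda>c w d. \<exists>T \<le> w. witness c T d"
  have "decidable 2 (\<lambda>e. \<not> ?P (e 1) (e 0))"
    by (intro decidable_not decidable_ex_le decidable_witness recursive_var) auto
  then obtain r1 where r1: "\<And>e. recf_eval r1 (map e [0..<2]) (of_bool (\<not> ?P (e 1) (e 0)))"
    unfolding decidable_def recursive_def by blast
  have "decidable 3 (\<lambda>e. \<not> ?Q (e 2) (e 1) (e 0))"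
    by (intro decidable_not decidable_ex_le decidable_witness recursive_var) auto
  then obtain r2 where r2: "\<And>e. recf_eval r2 (map e [0..<3]) (of_bool (\<not> ?Q (e 2) (e 1) (e 0)))"
    unfolding decidable_def recursive_def by blast
  have "recursive 1 (\<lambda>e. Suc (2 * e 0))"
    by (intro recursive_Suc recursive_mult recursive_const recursive_var) simp
  then obtain r3 where r3: "\<And>e. recf_eval r3 (map e [0..<1]) (Suc (2 * e 0))"
    unfolding recursive_def by blast
  have e1: "recf_eval r1 [w, c] (of_bool (\<not> ?P c w))" for c w
    using r1[of "case_nat w (\<lambda>_. c)"] by (simp add: numeral_2_eq_2)
  have e2: "recf_eval r2 [d, w, c] (of_bool (\<not> ?Q c w d))" for c w d
    using r2[of "case_nat d (case_nat w (\<lambda>_. c))"] by (simp add: numeral_3_eq_3 numeral_2_eq_2)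
  have e3: "recf_eval r3 [d] (Suc (2 * d))" for d using r3[of "\<lambda>_. d"] by simp
  define r where "r = Comp r3 [Comp (Mu r2) [Mu r1, Proj 0]]"
  have "\<exists>G :: nat monoid. finite_group G \<and> \<Gamma> = power_graph G \<and>
     recf_eval r [digraph_code \<Gamma>] (output_code (Digraph (directed_power_graph G)))"
    if \<Gamma>: "is_power_graph \<Gamma>" for \<Gamma> :: "nat pair_pre_digraph"
  proof -
    let ?c = "digraph_code \<Gamma>"
    obtain K :: "nat monoid" where K: "finite_group K" "\<Gamma> = power_graph K"
      using \<Gamma> by (auto simp: is_power_graph_def)
    obtain T d where "witness ?c T d" using witness_complete[OF K(1)] K(2) by blast
    then have "?P ?c (max T d)" by (meson max.cobounded1 max.cobounded2)
    then have exP: "\<exists>w. ?P ?c w" by blast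
    define w where "w = (LEAST w. ?P ?c w)"
    have "?P ?c w" unfolding w_def using exP by (rule LeastI_ex)
    then have exQ: "\<exists>d. ?Q ?c w d" by blast
    define d0 where "d0 = (LEAST d. ?Q ?c w d)"
    have "?Q ?c w d0" unfolding d0_def using exQ by (rule LeastI_ex)
    then obtain G :: "nat monoid" where G: "finite_group G" "?c = digraph_code (power_graph G)"
      "d0 = digraph_code (directed_power_graph G)"
      using witness_sound by blast
    have "pair_fin_digraph \<Gamma>" "pair_fin_digraph (power_graph G)"
      using pair_graph_power_graph[OF K(1)] pair_graph_power_graph[OF G(1)] K(2)
      by (auto simp: pair_graph_def pair_digraph_def)
    then have "\<Gamma> = power_graph G" using G(2) by (rule digraph_code_inject)
    moreover have "recf_eval r [?c] (output_code (Digraph (directed_power_graph G)))"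
    proof -
      have m1: "recf_eval (Mu r1) [?c] w"
        unfolding w_def by (rule eval_Mu_Least[OF e1 exP])
      have m2: "recf_eval (Mu r2) [w, ?c] d0"
        unfolding d0_def by (rule eval_Mu_Least[OF e2 exQ])
      have "recf_eval (Comp (Mu r2) [Mu r1, Proj 0]) [?c] d0"
        by (rule eval_Comp[OF _ m2]) (use m1 eval_Proj[of 0 "[?c]"] in simp)
      then have "recf_eval r [?c] (Suc (2 * d0))"
        unfolding r_def by (intro eval_Comp[OF _ e3]) simp
      then show ?thesis using G(3) by (simp add: sum_encode_def)
    qed
    ultimately show ?thesis using G(1) by blast
  qed
  then show ?thesis by blast
qed

section \<open>Isomorphic power graphs\<close>

lemma fin_group_of_finite_group: "finite_group G \<Longrightarrow> fin_group G"
  by (simp add: finite_group_def fin_group_def fin_group_axioms_def)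

lemma cyc_iff_positive_power:
  assumes "fin_group G" "x \<in> carrier G"
  shows "y \<in> cyc G x \<longleftrightarrow> (\<exists>m::nat. m > 0 \<and> y = x [^]\<^bsub>G\<^esub> m)"
proof
  interpret fin_group G by (rule assms)
  assume "y \<in> cyc G x"
  then obtain k where k: "y = x [^]\<^bsub>G\<^esub> (k::nat)" unfolding cyc_def by blast
  have "x [^]\<^bsub>G\<^esub> (k + ord x) = y" using k assms(2) by (simp add: nat_pow_mult[symmetric])
  then show "\<exists>m::nat. m > 0 \<and> y = x [^]\<^bsub>G\<^esub> m" using ord_pos[OF assms(2)] by (metis add_gr_0)
qed (auto simp: cyc_def)

lemma parcs_directed_power_graph:
  assumes "fin_group G"
  shows "(x, y) \<in> parcs (directed_power_graph G) \<longleftrightarrow>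
    x \<in> carrier G \<and> y \<in> carrier G \<and> x \<noteq> y \<and> y \<in> cyc G x"
  using cyc_iff_positive_power[OF assms] by (auto simp: directed_power_graph_def)

lemma nbh_eq_power_graph:
  assumes "fin_group G" "x \<in> carrier G"
  shows "nbh G x = {y \<in> carrier G. y = x \<or> (x, y) \<in> parcs (power_graph G)}"
  using cyc_iff_positive_power[OF assms(1)] fin_group.cyc_self[OF assms] assms(2)
  by (auto simp: nbh_def power_graph_def)

lemma digraph_iso_of_bij:
  assumes wf: "parcs D \<subseteq> pverts D \<times> pverts D" "parcs D' \<subseteq> pverts D' \<times> pverts D'"
    and f: "bij_betw f (pverts D) (pverts D')"
    and arcs: "\<And>x y. x \<in> pverts D \<Longrightarrow> y \<in> pverts D \<Longrightarrow> (x, y) \<in> parcs D \<longleftrightarrow> (f x, f y) \<in> parcs D'"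
  shows "digraph_iso (with_proj D) (with_proj D')"
proof -
  let ?h = "\<lparr>iso_verts = f, iso_arcs = map_prod f f, iso_head = snd, iso_tail = fst\<rparr>"
  have inj: "inj_on f (pverts D)" and img: "f ` pverts D = pverts D'"
    using f by (auto simp: bij_betw_def)
  have "inj_on (map_prod f f) (parcs D)"
    using map_prod_inj_on[OF inj inj] wf(1) by (rule inj_on_subset)
  moreover have "wf_digraph (with_proj D)" using wf(1) by unfold_locales auto
  ultimately have "pre_digraph.digraph_isomorphism (with_proj D) ?h"
    using inj by (auto simp: pre_digraph.digraph_isomorphism_def)
  moreover have "map_prod f f ` parcs D = parcs D'"
  proof (intro equalityI subsetI)
    fix a assume "a \<in> map_prod f f ` parcs D"
    then show "a \<in> parcs D'" using wf(1) arcs by auto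
  next
    fix a assume a: "a \<in> parcs D'"
    then obtain x y where "x \<in> pverts D" "y \<in> pverts D" "a = (f x, f y)"
      using wf(2) img by (cases a) blast
    then show "a \<in> map_prod f f ` parcs D" using arcs a by force
  qed
  then have "with_proj D' = app_iso ?h (with_proj D)"
    using img by (simp add: app_iso_def with_proj_def)
  ultimately show ?thesis unfolding digraph_iso_def by blast
qed

lemma bij_of_digraph_iso:
  assumes "digraph_iso (with_proj D) (with_proj D')" and wf: "parcs D \<subseteq> pverts D \<times> pverts D"
  obtains f where "bij_betw f (pverts D) (pverts D')"
    "\<And>x y. x \<in> pverts D \<Longrightarrow> y \<in> pverts D \<Longrightarrow> (x, y) \<in> parcs D \<longleftrightarrow> (f x, f y) \<in> parcs D'"
proof -
  obtain h where h: "pre_digraph.digraph_isomorphism (with_proj D) h"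
    and eq: "with_proj D' = app_iso h (with_proj D)"
    using assms unfolding digraph_iso_def by blast
  let ?f = "iso_verts h"
  have inj: "inj_on ?f (pverts D)" using h by (simp add: pre_digraph.digraph_isomorphism_def)
  have v: "pverts D' = ?f ` pverts D" and a: "parcs D' = iso_arcs h ` parcs D"
    and t: "iso_tail h = fst" "iso_head h = snd"
    using eq by (auto simp: with_proj_def app_iso_def)
  have ia: "iso_arcs h b = (?f (fst b), ?f (snd b))" if "b \<in> parcs D" for b
    using h that t by (simp add: pre_digraph.digraph_isomorphism_def prod_eq_iff)
  have arcs: "(x, y) \<in> parcs D \<longleftrightarrow> (?f x, ?f y) \<in> parcs D'" if xy: "x \<in> pverts D" "y \<in> pverts D" for x y
  proof
    assume "(x, y) \<in> parcs D"
    then show "(?f x, ?f y) \<in> parcs D'" using ia unfolding a by force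
  next
    assume "(?f x, ?f y) \<in> parcs D'"
    then obtain b where b: "b \<in> parcs D" "(?f x, ?f y) = iso_arcs h b" unfolding a by blast
    then have "?f x = ?f (fst b)" "?f y = ?f (snd b)" using ia by auto
    moreover have "fst b \<in> pverts D" "snd b \<in> pverts D" using b(1) wf by auto
    ultimately have "x = fst b" "y = snd b" using inj xy by (auto dest: inj_onD)
    then show "(x, y) \<in> parcs D" using b(1) by simp
  qed
  have "bij_betw ?f (pverts D) (pverts D')" using inj v by (simp add: bij_betw_def)
  then show ?thesis using arcs that by blast
qed

text \<open>
  Transport of structure, which reduces isomorphic power graphs to equal ones.
\<close>

lemma pull_back_group:
  fixes H :: "('a, 'b) monoid_scheme" and f :: "'c \<Rightarrow> 'a"
  assumes H: "fin_group H" and f: "bij_betw f V (carrier H)"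
  obtains K :: "'c monoid" where "fin_group K" "carrier K = V"
    "\<And>x y. x \<in> V \<Longrightarrow> y \<in> V \<Longrightarrow> y \<in> cyc K x \<longleftrightarrow> f y \<in> cyc H (f x)"
proof -
  interpret H: fin_group H by (rule H)
  define g where "g = the_inv_into V f"
  have inj: "inj_on f V" and fc: "\<And>x. x \<in> V \<Longrightarrow> f x \<in> carrier H"
    using f by (auto simp: bij_betw_def)
  have fg: "f (g z) = z" and gV: "g z \<in> V" if "z \<in> carrier H" for z
    using f that by (auto simp: g_def bij_betw_def f_the_inv_into_f intro: the_inv_into_into)
  have gf: "g (f x) = x" if "x \<in> V" for x using inj that by (simp add: g_def the_inv_into_f_f)
  define K where "K = \<lparr>carrier = V, monoid.mult = (\<lambda>x y. g (f x \<otimes>\<^bsub>H\<^esub> f y)), one = g \<one>\<^bsub>H\<^esub>\<rparr>"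
  have "group K"
  proof (rule groupI)
    fix x assume x: "x \<in> carrier K"
    then have "g (inv\<^bsub>H\<^esub> f x) \<in> carrier K" "g (inv\<^bsub>H\<^esub> f x) \<otimes>\<^bsub>K\<^esub> x = \<one>\<^bsub>K\<^esub>"
      by (simp_all add: K_def fc fg gV)
    then show "\<exists>y \<in> carrier K. y \<otimes>\<^bsub>K\<^esub> x = \<one>\<^bsub>K\<^esub>" by blast
  qed (auto simp: K_def fc fg gV gf H.m_assoc)
  moreover have "finite V" using f H.fin by (simp add: bij_betw_finite)
  ultimately have K: "fin_group K" by (simp add: fin_group_def fin_group_axioms_def K_def)
  have pow: "x [^]\<^bsub>K\<^esub> k = g (f x [^]\<^bsub>H\<^esub> k)" if "x \<in> V" for x and k :: nat
  proof (induction k)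
    case (Suc k)
    then show ?case using that by (simp add: K_def fc fg)
  qed (simp add: K_def)
  have "y \<in> cyc K x \<longleftrightarrow> f y \<in> cyc H (f x)" if "x \<in> V" "y \<in> V" for x y
    unfolding cyc_def using that pow[OF that(1)] fc fg gf
    by (auto simp: image_iff) (metis H.nat_pow_closed)+
  then show ?thesis using that K by (simp add: K_def)
qed

theorem directed_power_graph_determined:
  fixes G :: "('a, 'b) monoid_scheme" and H :: "('c, 'd) monoid_scheme"
  assumes G: "finite_group G" and H: "finite_group H"
    and iso: "digraph_iso (with_proj (power_graph G)) (with_proj (power_graph H))"
  shows "digraph_iso (with_proj (directed_power_graph G)) (with_proj (directed_power_graph H))"
proof -
  have fG: "fin_group G" and fH: "fin_group H" using G H by (auto intro: fin_group_of_finite_group)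
  obtain f where "bij_betw f (pverts (power_graph G)) (pverts (power_graph H))"
    and "\<And>x y. x \<in> pverts (power_graph G) \<Longrightarrow> y \<in> pverts (power_graph G) \<Longrightarrow>
      (x, y) \<in> parcs (power_graph G) \<longleftrightarrow> (f x, f y) \<in> parcs (power_graph H)"
    using bij_of_digraph_iso[OF iso] by (auto simp: power_graph_def)
  then have f: "bij_betw f (carrier G) (carrier H)"
    and arcs: "\<And>x y. x \<in> carrier G \<Longrightarrow> y \<in> carrier G \<Longrightarrow>
      (x, y) \<in> parcs (power_graph G) \<longleftrightarrow> (f x, f y) \<in> parcs (power_graph H)"
    by (auto simp: power_graph_def)
  have fc: "f x \<in> carrier H" if "x \<in> carrier G" for x using f that by (rule bij_betw_apply)
  obtain K :: "'a monoid" where K: "fin_group K" "carrier K = carrier G"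
    and cycK: "\<And>x y. x \<in> carrier G \<Longrightarrow> y \<in> carrier G \<Longrightarrow> y \<in> cyc K x \<longleftrightarrow> f y \<in> cyc H (f x)"
    using pull_back_group[OF fH f] by blast
  have "nbh K x = nbh G x" if x: "x \<in> carrier G" for x
  proof -
    have "y \<in> nbh K x \<longleftrightarrow> y \<in> nbh G x" if y: "y \<in> carrier G" for y
    proof -
      have "y \<in> nbh K x \<longleftrightarrow> f y \<in> nbh H (f x)"
        using cycK x y fc K(2) by (simp add: nbh_def)
      also have "\<dots> \<longleftrightarrow> f y = f x \<or> (f x, f y) \<in> parcs (power_graph H)"
        using nbh_eq_power_graph[OF fH fc[OF x]] fc[OF y] by simp
      also have "\<dots> \<longleftrightarrow> y \<in> nbh G x"
        using nbh_eq_power_graph[OF fG x] arcs[OF x y] f x y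
        by (auto simp: bij_betw_def dest: inj_onD)
      finally show ?thesis .
    qed
    then show ?thesis using K(2) unfolding nbh_def by blast
  qed
  then interpret two_groups G K
    using fG K by (simp add: two_groups_def two_groups_axioms_def)
  obtain g where g: "bij_betw g (carrier G) (carrier G)"
    and cycg: "\<And>x y. x \<in> carrier G \<Longrightarrow> y \<in> carrier G \<Longrightarrow> y \<in> cyc G x \<longleftrightarrow> g y \<in> cyc K (g x)"
    using directed_bijection by blast
  have gc: "g x \<in> carrier G" if "x \<in> carrier G" for x using g that by (rule bij_betw_apply)
  have bij: "bij_betw (f \<circ> g) (carrier G) (carrier H)" using g f by (rule bij_betw_trans)
  show ?thesis
  proof (rule digraph_iso_of_bij)
    show "bij_betw (f \<circ> g) (pverts (directed_power_graph G)) (pverts (directed_power_graph H))"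
      using bij by (simp add: directed_power_graph_def)
    fix x y assume "x \<in> pverts (directed_power_graph G)" "y \<in> pverts (directed_power_graph G)"
    then have xy: "x \<in> carrier G" "y \<in> carrier G" by (auto simp: directed_power_graph_def)
    have "y \<in> cyc G x \<longleftrightarrow> f (g y) \<in> cyc H (f (g x))"
      using cycg[OF xy] cycK gc xy by simp
    moreover have "x = y \<longleftrightarrow> f (g x) = f (g y)"
      using inj_on_eq_iff[OF bij_betw_imp_inj_on[OF bij] xy] by simp
    ultimately show "(x, y) \<in> parcs (directed_power_graph G) \<longleftrightarrow>
        ((f \<circ> g) x, (f \<circ> g) y) \<in> parcs (directed_power_graph H)"
      using parcs_directed_power_graph[OF fG] parcs_directed_power_graph[OF fH] xy gc fc by simp
  qed (auto simp: directed_power_graph_def)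
qed

lemma digraph_iso_refl:
  assumes "parcs D \<subseteq> pverts D \<times> pverts D"
  shows "digraph_iso (with_proj D) (with_proj D)"
  using assms by (intro digraph_iso_of_bij[of _ _ id]) auto

theorem mainTheorem1:
  shows "\<exists>(r :: recf) (out :: nat pair_pre_digraph \<Rightarrow> proc_output).
    (\<forall>\<Gamma>. is_power_graph \<Gamma> \<longrightarrow>
       recf_eval r [digraph_code \<Gamma>] (output_code (out \<Gamma>)) \<and>
       correct_output \<Gamma> (out \<Gamma>)) \<and>
    (\<forall>\<Gamma> \<Gamma>'. is_power_graph \<Gamma> \<and> is_power_graph \<Gamma>' \<and>
       digraph_iso (with_proj \<Gamma>) (with_proj \<Gamma>') \<longrightarrow>
       output_iso (out \<Gamma>) (out \<Gamma>'))"
proof -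
  obtain r where "\<forall>\<Gamma>. is_power_graph \<Gamma> \<longrightarrow> (\<exists>G :: nat monoid. finite_group G \<and> \<Gamma> = power_graph G \<and>
      recf_eval r [digraph_code \<Gamma>] (output_code (Digraph (directed_power_graph G))))"
    using reconstruction_program by blast
  then obtain grp :: "nat pair_pre_digraph \<Rightarrow> nat monoid" where
    grp: "\<And>\<Gamma>. is_power_graph \<Gamma> \<Longrightarrow> finite_group (grp \<Gamma>) \<and> \<Gamma> = power_graph (grp \<Gamma>) \<and>
      recf_eval r [digraph_code \<Gamma>] (output_code (Digraph (directed_power_graph (grp \<Gamma>))))"
    by metis
  have refl: "digraph_iso (with_proj (power_graph G)) (with_proj (power_graph G))" for G :: "nat monoid"
    by (rule digraph_iso_refl) (auto simp: power_graph_def)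
  let ?out = "\<lambda>\<Gamma>. Digraph (directed_power_graph (grp \<Gamma>))"
  have "correct_output \<Gamma> (?out \<Gamma>)" if "is_power_graph \<Gamma>" for \<Gamma>
    using grp[OF that] pair_digraph_directed_power_graph directed_power_graph_determined refl
    by (metis correct_output.simps(2))
  moreover have "output_iso (?out \<Gamma>) (?out \<Gamma>')"
    if "is_power_graph \<Gamma>" "is_power_graph \<Gamma>'" "digraph_iso (with_proj \<Gamma>) (with_proj \<Gamma>')" for \<Gamma> \<Gamma>'
    using directed_power_graph_determined[of "grp \<Gamma>" "grp \<Gamma>'"] grp[OF that(1)] grp[OF that(2)] that(3)
    by simp
  ultimately show ?thesis
    using grp by (intro exI[of _ r] exI[of _ ?out]) blast
qed

end
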